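(* Let $r\ge 3$ and $n\in\mathbb{N}$ with $(r-2)\mid n$. Then the threshold for the random graph $G(n,p)$ to contain a copy of $K_{r,2,n}$ is $\Theta(n^{-2/(r+1)})$; i.e. there is $p^*(n)=\Theta(n^{-2/(r+1)})$ such that $\mathbb{P}[K_{r,2,n}\subseteq G(n,p)]\to 0$ if $p=o(p^* )$ and $\to 1$ if $p=\omega(p^* )$ (as $n\to\infty$ along $n$ divisible by $r-2$).
   Context: For integers $r>s\ge 0$ and $n$ with $(r-s)\mid n$, $K_{r,s,n}$ is the graph on vertex set $\mathbb{Z}_n=\{0,\dots,n-1\}$ whose edge set is the union of the edge sets of $n/(r-s)$ cliques: for each $i\in\{0,\dots,n/(r-s)-1\}$ there is a copy of $K_r$ on the vertices $i(r-s),i(r-s)+1,\dots,i(r-s)+r-1$ (modulo $n$). For $s=2$ consecutive cliques share exactly one edge; for $r=3$, $K_{3,2,n}$ is the square of a Hamilton cycle. "$K_{r,2,n}\subseteq G(n,p)$" means $G(n,p)$ contains a copy of $K_{r,2,n}$. *)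

theory Defs
  imports "HOL-Probability.Probability" "HOL-Probability.Product_PMF"
    "HOL-Library.Landau_Symbols" "HOL-Library.Ramsey"
begin

text \<open>A simple graph is a pair (vertex set, set of two-element edges).
  \<^term>\<open>nsets A 2\<close> is the set of two-element subsets of \<^term>\<open>A\<close>.\<close>

type_synonym 'a graph = "'a set \<times> 'a set set"

definition contains_copy :: "'a graph \<Rightarrow> 'b graph \<Rightarrow> bool" where
  "contains_copy H G \<longleftrightarrow>
     (\<exists>f. inj_on f (fst H) \<and> f ` fst H \<subseteq> fst G \<and> (\<forall>e\<in>snd H. f ` e \<in> snd G))"

definition clique_block :: "nat \<Rightarrow> nat \<Rightarrow> nat \<Rightarrow> nat \<Rightarrow> nat set" where
  "clique_block r s n i = (\<lambda>j. (i * (r - s) + j) mod n) ` {..<r}"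

text \<open>Intended for \<^term>\<open>s < r\<close> and \<^term>\<open>(r - s) dvd n\<close>.\<close>

definition clique_cycle :: "nat \<Rightarrow> nat \<Rightarrow> nat \<Rightarrow> nat graph" where
  "clique_cycle r s n =
     ({..<n}, \<Union>i<n div (r - s). nsets (clique_block r s n i) 2)"

definition random_graph :: "nat \<Rightarrow> real \<Rightarrow> nat graph pmf" where
  "random_graph n p =
     map_pmf (\<lambda>X. ({..<n}, {e \<in> nsets {..<n} 2. X e}))
       (Pi_pmf (nsets {..<n} 2) False (\<lambda>_. bernoulli_pmf p))"

text \<open>Thresholds are taken along a filter so that \<^term>\<open>n\<close> may be restricted to an
  infinite set of integers; \<^term>\<open>Q n\<close> is the graph property considered on \<^term>\<open>n\<close> vertices.\<close>

definition is_threshold ::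
    "nat filter \<Rightarrow> (nat \<Rightarrow> nat graph \<Rightarrow> bool) \<Rightarrow> (nat \<Rightarrow> real) \<Rightarrow> bool" where
  "is_threshold F Q pstar \<longleftrightarrow>
     (\<forall>p. (\<forall>n. 0 \<le> p n \<and> p n \<le> 1) \<longrightarrow>
        (p \<in> o[F](pstar) \<longrightarrow>
           ((\<lambda>n. measure_pmf.prob (random_graph n (p n)) {G. Q n G}) \<longlongrightarrow> 0) F) \<and>
        (p \<in> \<omega>[F](pstar) \<longrightarrow>
           ((\<lambda>n. measure_pmf.prob (random_graph n (p n)) {G. Q n G}) \<longlongrightarrow> 1) F))"

end

theory Submission
  imports Defs
begin

text \<open>
  Below the threshold the expected number of copies tends to 0. Above it, expose the random graph
  in two rounds of density \<open>p = C n\<^bsup>-2/(r+1)\<^esup>\<close>. Let \<open>S\<close> be a uniformly random copy of the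
  cycle \<open>K\<close>. A subgraph \<open>T\<close> of \<open>K\<close> with \<open>c\<close> components on \<open>v\<close> vertices lies in \<open>S\<close> with
  probability at most \<open>(const)\<^bsup>v\<^esup> n\<^bsup>c-v\<^esup>\<close>. A chain of cliques on \<open>u\<close> vertices has at most
  \<open>(r+1)(u-2)/2 + 1\<close> edges, so relative to \<open>p\<^bsup>|T|\<^esup>\<close> each component gains a factor
  \<open>n\<^bsup>-(r-1)/(r+1)\<^esup>\<close> and each edge a factor \<open>O(1/C)\<close>.

  In the first round the minimal-fragment argument of Park and Pham shows that for almost all
  copies \<open>S\<close> some copy inside \<open>S \<union> W\<close> has fewer than \<open>n\<^bsup>2/(r+1)\<^esup>\<close> edges outside the random
  set \<open>W\<close>. Such small fragments leave room for only boundedly many (weighted) choices of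
  components since \<open>2 \<le> r - 1\<close>, so a second moment computation finds one of them in the
  second round.
\<close>

subsection \<open>Random subsets\<close>

text \<open>The general theorem on spread families would give the threshold only up to a logarithmic
  factor; the gain per component removes it. Let \<open>y\<close> be that gain. The weighted sum
  over all subgraphs of the opened cycle is governed by the at most \<open>n\<close> places where a
  component can start, and is at most \<open>exp (t / 2)\<close> with \<open>t = n * y\<close>. This
  is the origin of the fragment size: fragments with at least \<open>t\<close> edges gain
  \<open>2 powr (- t)\<close>, which wins. A fragment with fewer than \<open>t\<close> edges offers
  at most \<open>2 * t\<close> places, and \<open>t * y\<close> is \<open>n\<close> to the power
  \<open>(3 - r) / (r + 1)\<close>, hence bounded. For \<open>r = 3\<close> the exponent is zero, so
  the second-moment error does not vanish with \<open>n\<close>; it is made small by the constant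
  \<open>C\<close> alone.

  The obstacle is the closed cycle: a long one has \<open>(r + 1) / 2\<close> edges per vertex
  without the deficit that chains have, so the density bound fails for it. It is therefore cut open
  at two cliques. Small fragments are rotated away from the seam; for large ones the few edges at
  the seam are simply discarded, at a cost polynomial in \<open>1 / p\<close>.\<close>

definition subset_weight :: "'a set \<Rightarrow> real \<Rightarrow> 'a set \<Rightarrow> real" where
  "subset_weight E p W = p ^ card W * (1 - p) ^ card (E - W)"

text \<open>Expectation over a random subset, kept as a finite sum so that induction on
  \<open>E\<close> and exchange of sums need no measure theory. \<open>prob_random_graph\<close>
  links it to the probability space.\<close>

definition subset_exp :: "'a set \<Rightarrow> real \<Rightarrow> ('a set \<Rightarrow> real) \<Rightarrow> real" where
  "subset_exp E p f = (\<Sum>W\<in>Pow E. subset_weight E p W * f W)"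

lemma subset_weight_nonneg: "0 \<le> p \<Longrightarrow> p \<le> 1 \<Longrightarrow> 0 \<le> subset_weight E p W"
  by (simp add: subset_weight_def)

lemma subset_exp_empty [simp]: "subset_exp {} p f = f {}"
  by (simp add: subset_exp_def subset_weight_def)

text \<open>Conditioning on \<open>e\<close>; this recursion carries the inductions over the ground
  set.\<close>

lemma subset_exp_insert:
  assumes "finite E" "e \<notin> E"
  shows "subset_exp (insert e E) p f
           = (1 - p) * subset_exp E p f + p * subset_exp E p (\<lambda>W. f (insert e W))"
proof -
  have inj: "inj_on (insert e) (Pow E)"
    using assms by (intro inj_onI) (metis Diff_insert_absorb PowD in_mono insert_ident)
  have fin: "finite W" if "W \<subseteq> E" for W using that assms finite_subset by blast
  have "subset_exp (insert e E) p f
      = (\<Sum>W\<in>Pow E. subset_weight (insert e E) p W * f W)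
        + (\<Sum>W\<in>insert e ` Pow E. subset_weight (insert e E) p W * f W)"
    unfolding subset_exp_def Pow_insert
    by (rule sum.union_disjoint) (use assms in auto)
  also have "(\<Sum>W\<in>insert e ` Pow E. subset_weight (insert e E) p W * f W)
      = (\<Sum>W\<in>Pow E. subset_weight (insert e E) p (insert e W) * f (insert e W))"
    by (subst sum.reindex[OF inj]) simp
  also have "\<dots> = p * subset_exp E p (\<lambda>W. f (insert e W))"
    unfolding subset_exp_def sum_distrib_left
  proof (rule sum.cong[OF refl])
    fix W assume W: "W \<in> Pow E"
    then have "e \<notin> W" "insert e E - insert e W = E - W" using assms by auto
    then show "subset_weight (insert e E) p (insert e W) * f (insert e W)
        = p * (subset_weight E p W * f (insert e W))"
      using fin W by (simp add: subset_weight_def)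
  qed
  also have "(\<Sum>W\<in>Pow E. subset_weight (insert e E) p W * f W) = (1 - p) * subset_exp E p f"
    unfolding subset_exp_def sum_distrib_left
  proof (rule sum.cong[OF refl])
    fix W assume W: "W \<in> Pow E"
    then have "insert e E - W = insert e (E - W)" using assms by auto
    then show "subset_weight (insert e E) p W * f W = (1 - p) * (subset_weight E p W * f W)"
      using assms by (simp add: subset_weight_def)
  qed
  finally show ?thesis .
qed

lemma subset_exp_const: "finite E \<Longrightarrow> subset_exp E p (\<lambda>_. c) = c"
  by (induction E rule: finite_induct) (simp_all add: subset_exp_insert algebra_simps)

lemma subset_exp_cmult: "subset_exp E p (\<lambda>W. c * f W) = c * subset_exp E p f"
  by (simp add: subset_exp_def sum_distrib_left mult_ac)

lemma subset_exp_diff: "subset_exp E p (\<lambda>W. f W - g W) = subset_exp E p f - subset_exp E p g"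
  by (simp add: subset_exp_def sum_subtractf algebra_simps)

lemma subset_exp_sum: "subset_exp E p (\<lambda>W. \<Sum>i\<in>I. f i W) = (\<Sum>i\<in>I. subset_exp E p (f i))"
  unfolding subset_exp_def sum_distrib_left by (rule sum.swap)

lemma subset_exp_mono:
  assumes "0 \<le> p" "p \<le> 1" "\<And>W. W \<subseteq> E \<Longrightarrow> f W \<le> g W"
  shows "subset_exp E p f \<le> subset_exp E p g"
  unfolding subset_exp_def
  by (intro sum_mono mult_left_mono subset_weight_nonneg) (use assms in auto)

lemma subset_exp_superset:
  assumes "finite E" "T \<subseteq> E"
  shows "subset_exp E p (\<lambda>W. of_bool (T \<subseteq> W)) = p ^ card T"
  using assms
proof (induction E arbitrary: T rule: finite_induct)
  case empty
  then show ?case by simp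
next
  case (insert e E)
  show ?case
  proof (cases "e \<in> T")
    case False
    then have "T \<subseteq> E" using insert.prems by auto
    moreover have "T \<subseteq> insert e W \<longleftrightarrow> T \<subseteq> W" for W using False by auto
    ultimately show ?thesis using insert.hyps
      by (simp add: subset_exp_insert insert.IH algebra_simps)
  next
    case True
    have fT: "finite T" using insert finite_subset by blast
    have "subset_exp E p (\<lambda>W. of_bool (T \<subseteq> W)) = subset_exp E p (\<lambda>_. 0)"
      unfolding subset_exp_def by (intro sum.cong) (use True insert.hyps in auto)
    moreover have "T \<subseteq> insert e W \<longleftrightarrow> T - {e} \<subseteq> W" for W by auto
    moreover have "subset_exp E p (\<lambda>W. of_bool (T - {e} \<subseteq> W)) = p ^ card (T - {e})"
      by (rule insert.IH) (use insert.prems in auto)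
    ultimately have "subset_exp (insert e E) p (\<lambda>W. of_bool (T \<subseteq> W)) = p * p ^ card (T - {e})"
      using insert.hyps by (simp add: subset_exp_insert subset_exp_const)
    also have "\<dots> = p ^ card T"
      using True fT by (metis card_Suc_Diff1 power_Suc)
    finally show ?thesis .
  qed
qed

text \<open>Two rounds of exposure: the union of independent random sets of densities \<open>p\<close> and \<open>p'\<close>
  is stochastically dominated by a random set of density \<open>q \<ge> p + p'\<close>.\<close>

lemma subset_exp_union_le:
  assumes "finite E" "0 \<le> p" "0 \<le> p'" "p + p' \<le> q" "q \<le> 1"
    and "\<And>A B. A \<subseteq> B \<Longrightarrow> f A \<le> f B"
  shows "subset_exp E p (\<lambda>W. subset_exp E p' (\<lambda>W'. f (W \<union> W'))) \<le> subset_exp E q f"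
  using assms(1,6)
proof (induction E arbitrary: f rule: finite_induct)
  case empty
  then show ?case by simp
next
  case (insert e E)
  note p = assms(2-5)
  define g where "g = (\<lambda>W. f (insert e W))"
  have mono_g: "g A \<le> g B" if "A \<subseteq> B" for A B
    unfolding g_def by (rule insert.prems) (use that in auto)
  define Uf where "Uf = subset_exp E p (\<lambda>W. subset_exp E p' (\<lambda>W'. f (W \<union> W')))"
  define Ug where "Ug = subset_exp E p (\<lambda>W. subset_exp E p' (\<lambda>W'. g (W \<union> W')))"
  have lin: "subset_exp E p (\<lambda>W. u * h W + v * h' W) = u * subset_exp E p h + v * subset_exp E p h'"
    for u v h h'
    by (simp add: subset_exp_def sum_distrib_left sum.distrib algebra_simps)
  \<comment> \<open>The union misses \<open>e\<close> with probability
    \<open>(1 - p) * (1 - p')\<close>; the three other cases all lead to \<open>g\<close>.\<close>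
  have eq: "subset_exp (insert e E) p (\<lambda>W. subset_exp (insert e E) p' (\<lambda>W'. f (W \<union> W')))
      = (1 - p) * (1 - p') * Uf + (1 - (1 - p) * (1 - p')) * Ug"
  proof -
    have ins: "insert e W \<union> W' = insert e (W \<union> W')" "W \<union> insert e W' = insert e (W \<union> W')" for W W'
      by auto
    show ?thesis
      unfolding subset_exp_insert[OF insert.hyps(1,2)] lin ins insert_absorb2 Uf_def Ug_def g_def
      by (simp only: algebra_simps)
  qed
  have Uf: "Uf \<le> subset_exp E q f" unfolding Uf_def by (rule insert.IH) (use insert.prems in auto)
  have Ug: "Ug \<le> subset_exp E q g" unfolding Ug_def by (rule insert.IH) (use mono_g in auto)
  have fg: "subset_exp E q f \<le> subset_exp E q g"
  proof (rule subset_exp_mono)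
    show "f W \<le> g W" for W unfolding g_def by (rule insert.prems) auto
  qed (use p in auto)
  have "(1 - p) * (1 - p') = 1 - p - p' + p * p'" by (simp add: algebra_simps)
  then have le: "1 - q \<le> (1 - p) * (1 - p')"
    using p mult_nonneg_nonneg[OF p(1,2)] by linarith
  have "(1 - p) * (1 - p') * Uf + (1 - (1 - p) * (1 - p')) * Ug
      \<le> (1 - p) * (1 - p') * subset_exp E q f + (1 - (1 - p) * (1 - p')) * subset_exp E q g"
  proof (intro add_mono mult_left_mono Uf Ug)
    show "0 \<le> (1 - p) * (1 - p')" using p by (intro mult_nonneg_nonneg) auto
    show "0 \<le> 1 - (1 - p) * (1 - p')"
      using p by (simp add: mult_le_one)
  qed
  \<comment> \<open>In terms of the nonnegative gap between the \<open>g\<close> and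
    \<open>f\<close> values, the expression decreases in \<open>(1 - p) * (1 - p')\<close>, so this
    coefficient may be lowered to \<open>1 - q\<close>.\<close>
  also have "\<dots> = subset_exp E q g - (1 - p) * (1 - p') * (subset_exp E q g - subset_exp E q f)"
    by (simp add: algebra_simps)
  also have "\<dots> \<le> subset_exp E q g - (1 - q) * (subset_exp E q g - subset_exp E q f)"
    using mult_right_mono[OF le, of "subset_exp E q g - subset_exp E q f"] fg by simp
  also have "\<dots> = subset_exp (insert e E) q f"
    using insert.hyps by (simp add: subset_exp_insert g_def algebra_simps)
  finally show ?case unfolding eq .
qed

lemma prob_random_graph:
  assumes "0 \<le> p" "p \<le> 1"
  shows "measure_pmf.prob (random_graph n p) {G. Q G}
           = subset_exp (nsets {..<n} 2) p (\<lambda>W. of_bool (Q ({..<n}, W)))"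
proof -
  define E :: "nat set set" where "E = nsets {..<n} 2"
  define M where "M = Pi_pmf E False (\<lambda>_. bernoulli_pmf p)"
  have finE: "finite E" unfolding E_def by (rule finite_imp_finite_nsets) simp
  have "measure_pmf.prob (random_graph n p) {G. Q G}
      = measure_pmf.prob M {X. Q ({..<n}, {e\<in>E. X e})}"
    by (simp add: random_graph_def E_def M_def vimage_def)
  also have "{X. Q ({..<n}, {e\<in>E. X e})}
      = (\<Union>W\<in>{W\<in>Pow E. Q ({..<n}, W)}. {X. {e\<in>E. X e} = W})"
    by auto
  also have "measure_pmf.prob M \<dots>
      = (\<Sum>W\<in>{W\<in>Pow E. Q ({..<n}, W)}. measure_pmf.prob M {X. {e\<in>E. X e} = W})"
    by (rule measure_pmf.finite_measure_finite_Union)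
       (use finE in \<open>auto simp: disjoint_family_on_def\<close>)
  also have "\<dots> = (\<Sum>W\<in>{W\<in>Pow E. Q ({..<n}, W)}. subset_weight E p W)"
  proof (rule sum.cong[OF refl])
    fix W assume "W \<in> {W\<in>Pow E. Q ({..<n}, W)}"
    then have WE: "W \<subseteq> E" by auto
    \<comment> \<open>The fibre over \<open>W\<close> is a product event with one singleton
      constraint per edge, so its probability factorises.\<close>
    have "{X. {e\<in>E. X e} = W} = Pi E (\<lambda>e. {e \<in> W})" using WE by (auto simp: Pi_def)
    then have "measure_pmf.prob M {X. {e\<in>E. X e} = W}
        = (\<Prod>e\<in>E. measure_pmf.prob (bernoulli_pmf p) {e \<in> W})"
      unfolding M_def using finE by (simp add: measure_Pi_pmf_Pi)
    also have "\<dots> = (\<Prod>e\<in>E. if e \<in> W then p else 1 - p)"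
      by (intro prod.cong refl) (use assms in \<open>auto simp: measure_pmf_single\<close>)
    also have "\<dots> = subset_weight E p W"
      using finE WE by (simp add: prod.If_cases subset_weight_def Int_absorb1 Diff_eq)
    finally show "measure_pmf.prob M {X. {e\<in>E. X e} = W} = subset_weight E p W" .
  qed
  also have "\<dots> = subset_exp E p (\<lambda>W. of_bool (Q ({..<n}, W)))"
    unfolding subset_exp_def
    by (rule sum.mono_neutral_cong_left) (use finE in auto)
  finally show ?thesis unfolding E_def .
qed

subsection \<open>Fragments and the second moment\<close>

text \<open>The argument of Park and Pham: let \<open>T = S j - W\<close> be a smallest fragment available inside
  \<open>W \<union> S i\<close>. By minimality every \<open>S k\<close> contained in \<open>W \<union> T\<close> contains \<open>T\<close>, so \<open>T\<close> is
  one of the subsets of a single hyperedge that depends only on \<open>W \<union> T\<close>.\<close>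

lemma expected_large_fragments_le:
  fixes S :: "'i \<Rightarrow> 'a set" and t :: real
  assumes finE: "finite E" and finI: "finite I" and SE: "\<And>i. i \<in> I \<Longrightarrow> S i \<subseteq> E"
    and p: "0 < p" "p \<le> 1" and \<eta>: "0 \<le> \<eta>"
    and bound: "\<And>i. i \<in> I \<Longrightarrow>
      (\<Sum>T\<in>{T. T \<subseteq> S i \<and> t \<le> real (card T)}. (1 / p) ^ card T * real (card {j\<in>I. T \<subseteq> S j})) \<le> \<eta>"
  shows "subset_exp E p (\<lambda>W. real (card {i\<in>I. \<not> (\<exists>j\<in>I. S j \<subseteq> W \<union> S i \<and> real (card (S j - W)) < t)})) \<le> \<eta>"
proof -
  define N where "N T = real (card {j\<in>I. T \<subseteq> S j})" for T
  define M where "M W = {T. T \<subseteq> E \<and> T \<inter> W = {} \<and> t \<le> real (card T) \<and> (\<exists>j\<in>I. S j - W = T)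
                      \<and> (\<forall>j\<in>I. S j \<subseteq> W \<union> T \<longrightarrow> T \<subseteq> S j)}" for W
  define Zs where "Zs = {Z. Z \<subseteq> E \<and> (\<exists>j\<in>I. S j \<subseteq> Z)}"
  \<comment> \<open>Any choice will do as long as it depends on \<open>Z\<close> only: the pair
    \<open>(W, T)\<close> is about to be recorded as \<open>(W \<union> T, T)\<close>, and
    \<open>T\<close> must be confined to few sets once \<open>Z = W \<union> T\<close> is
    known.\<close>
  define sel where "sel Z = (SOME j. j \<in> I \<and> S j \<subseteq> Z)" for Z
  have sel: "sel Z \<in> I" "S (sel Z) \<subseteq> Z" if "Z \<in> Zs" for Z
    using someI_ex[of "\<lambda>j. j \<in> I \<and> S j \<subseteq> Z"] that unfolding Zs_def sel_def by auto
  define Q where "Q Z = {T. T \<subseteq> S (sel Z) \<and> t \<le> real (card T)}" for Z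
  have finS: "finite (S i)" if "i \<in> I" for i using SE[OF that] finE finite_subset by blast
  have finM: "finite (M W)" for W
    by (rule finite_subset[of _ "Pow E"]) (use finE in \<open>auto simp: M_def\<close>)
  have finZs: "finite Zs" by (rule finite_subset[of _ "Pow E"]) (use finE in \<open>auto simp: Zs_def\<close>)
  have finQ: "finite (Q Z)" if "Z \<in> Zs" for Z
    by (rule finite_subset[of _ "Pow (S (sel Z))"]) (use finS sel that in \<open>auto simp: Q_def\<close>)
  have bad: "real (card {i\<in>I. \<not> (\<exists>j\<in>I. S j \<subseteq> W \<union> S i \<and> real (card (S j - W)) < t)}) \<le> (\<Sum>T\<in>M W. N T)"
    if W: "W \<subseteq> E" for W
  proof -
    have "{i\<in>I. \<not> (\<exists>j\<in>I. S j \<subseteq> W \<union> S i \<and> real (card (S j - W)) < t)} \<subseteq> (\<Union>T\<in>M W. {i\<in>I. T \<subseteq> S i})"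
    proof
      fix i assume i: "i \<in> {i\<in>I. \<not> (\<exists>j\<in>I. S j \<subseteq> W \<union> S i \<and> real (card (S j - W)) < t)}"
      then have iI: "i \<in> I" by auto
      have ex: "i \<in> I \<and> S i \<subseteq> W \<union> S i" using iI by auto
      define j where "j = (ARG_MIN (\<lambda>j. card (S j - W)) j. j \<in> I \<and> S j \<subseteq> W \<union> S i)"
      have j: "j \<in> I" "S j \<subseteq> W \<union> S i"
        using arg_min_natI[of "\<lambda>j. j \<in> I \<and> S j \<subseteq> W \<union> S i", OF ex] unfolding j_def by auto
      have jmin: "card (S j - W) \<le> card (S k - W)" if "k \<in> I" "S k \<subseteq> W \<union> S i" for k
        unfolding j_def by (rule arg_min_nat_le) (use that in auto)
      define T where "T = S j - W"
      have finT: "finite T" unfolding T_def using finS j by auto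
      have "T \<subseteq> S k" if k: "k \<in> I" "S k \<subseteq> W \<union> T" for k
      proof -
        have "S k \<subseteq> W \<union> S i" using k j by (auto simp: T_def)
        then have "card T \<le> card (S k - W)" unfolding T_def using jmin k by blast
        moreover have "S k - W \<subseteq> T" using k by auto
        ultimately have "S k - W = T" using finT card_seteq by blast
        then show ?thesis by auto
      qed
      moreover have "t \<le> real (card T)" using i j unfolding T_def by force
      moreover have "T \<subseteq> E" using j SE by (auto simp: T_def)
      ultimately have "T \<in> M W" unfolding M_def using j by (auto simp: T_def)
      moreover have "T \<subseteq> S i" using j by (auto simp: T_def)
      ultimately show "i \<in> (\<Union>T\<in>M W. {i\<in>I. T \<subseteq> S i})" using iI by auto
    qed
    then have "card {i\<in>I. \<not> (\<exists>j\<in>I. S j \<subseteq> W \<union> S i \<and> real (card (S j - W)) < t)}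
        \<le> card (\<Union>T\<in>M W. {i\<in>I. T \<subseteq> S i})"
      by (rule card_mono[rotated]) (use finM finI in auto)
    also have "\<dots> \<le> (\<Sum>T\<in>M W. card {i\<in>I. T \<subseteq> S i})" by (rule card_UN_le[OF finM])
    finally show ?thesis unfolding N_def of_nat_sum[symmetric] of_nat_le_iff .
  qed
  have "subset_exp E p (\<lambda>W. real (card {i\<in>I. \<not> (\<exists>j\<in>I. S j \<subseteq> W \<union> S i \<and> real (card (S j - W)) < t)}))
      \<le> subset_exp E p (\<lambda>W. \<Sum>T\<in>M W. N T)"
    by (rule subset_exp_mono) (use p bad in auto)
  also have "\<dots> = (\<Sum>(W, T)\<in>(SIGMA W:Pow E. M W). subset_weight E p W * N T)"
    unfolding subset_exp_def sum_distrib_left by (rule sum.Sigma) (use finE finM in auto)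
  also have "\<dots> \<le> (\<Sum>(W, T)\<in>(SIGMA W:Pow E. M W). subset_weight E p (W \<union> T) * ((1 / p) ^ card T * N T))"
  proof (rule sum_mono, clarify)
    fix W T assume WE: "W \<subseteq> E" and T: "T \<in> M W"
    have TE: "T \<subseteq> E" "T \<inter> W = {}" using T unfolding M_def by auto
    have fin: "finite W" "finite T" using WE TE finE finite_subset by blast+
    have c1: "card (W \<union> T) = card W + card T" using fin TE by (simp add: card_Un_disjoint Int_commute)
    have "E - W = (E - (W \<union> T)) \<union> T" using TE WE by auto
    then have c2: "card (E - W) = card (E - (W \<union> T)) + card T"
      using finE fin by (simp add: card_Un_disjoint Diff_Int_distrib2 Int_Un_distrib
          card_Un_disjoint[of "E - (W \<union> T)" T] disjoint_iff)
    \<comment> \<open>Moving \<open>T\<close> into the random set: each element trades a factor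
      \<open>1 - p\<close>, estimated by 1, for a factor \<open>p\<close> that is divided out again.
      This produces the weights \<open>(1 / p) ^ card T\<close>.\<close>
    have "subset_weight E p W \<le> p ^ card W * (1 - p) ^ card (E - (W \<union> T))"
      unfolding subset_weight_def c2 power_add
      using p by (intro mult_left_mono mult_left_le power_le_one mult_nonneg_nonneg) auto
    also have "\<dots> = subset_weight E p (W \<union> T) * (1 / p) ^ card T"
      using p by (simp add: subset_weight_def c1 power_add power_divide)
    finally have "subset_weight E p W * N T \<le> subset_weight E p (W \<union> T) * (1 / p) ^ card T * N T"
      by (rule mult_right_mono) (simp add: N_def)
    then show "subset_weight E p W * N T \<le> subset_weight E p (W \<union> T) * ((1 / p) ^ card T * N T)"
      by (simp add: mult_ac)
  qed
  also have "\<dots> \<le> (\<Sum>(Z, T)\<in>(SIGMA Z:Zs. Q Z). subset_weight E p Z * ((1 / p) ^ card T * N T))"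
  proof -
    define h where "h = (\<lambda>(W::'a set, T::'a set). (W \<union> T, T))"
    \<comment> \<open>\<open>T\<close> is disjoint from \<open>W\<close>, so \<open>W\<close> is the
      union minus \<open>T\<close>.\<close>
    have inj: "inj_on h (SIGMA W:Pow E. M W)"
      unfolding h_def by (rule inj_onI) (auto simp: M_def)
    have sub: "h ` (SIGMA W:Pow E. M W) \<subseteq> (SIGMA Z:Zs. Q Z)"
    proof
      fix z assume "z \<in> h ` (SIGMA W:Pow E. M W)"
      then obtain W T where WT: "z = h (W, T)" and W: "W \<subseteq> E" and T: "T \<in> M W" by auto
      define Z where "Z = W \<union> T"
      have Z: "Z \<in> Zs" using W T unfolding Z_def Zs_def M_def by auto
      have "T \<subseteq> S (sel Z)" using T sel[OF Z] unfolding M_def Z_def by auto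
      then have "T \<in> Q Z" using T unfolding Q_def M_def by auto
      then show "z \<in> (SIGMA Z:Zs. Q Z)" using Z by (simp add: WT h_def Z_def)
    qed
    have "(\<Sum>(W, T)\<in>(SIGMA W:Pow E. M W). subset_weight E p (W \<union> T) * ((1 / p) ^ card T * N T))
        = (\<Sum>(Z, T)\<in>h ` (SIGMA W:Pow E. M W). subset_weight E p Z * ((1 / p) ^ card T * N T))"
      by (subst sum.reindex[OF inj]) (auto simp: h_def intro!: sum.cong)
    also have "\<dots> \<le> (\<Sum>(Z, T)\<in>(SIGMA Z:Zs. Q Z). subset_weight E p Z * ((1 / p) ^ card T * N T))"
    proof (rule sum_mono2[OF _ sub])
      show "finite (SIGMA Z:Zs. Q Z)" using finZs finQ by auto
    qed (use p in \<open>auto simp: N_def intro!: mult_nonneg_nonneg subset_weight_nonneg\<close>)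
    finally show ?thesis .
  qed
  also have "\<dots> = (\<Sum>Z\<in>Zs. \<Sum>T\<in>Q Z. subset_weight E p Z * ((1 / p) ^ card T * N T))"
    by (rule sum.Sigma[symmetric]) (use finZs finQ in auto)
  also have "\<dots> = (\<Sum>Z\<in>Zs. subset_weight E p Z * (\<Sum>T\<in>Q Z. (1 / p) ^ card T * N T))"
    by (simp add: sum_distrib_left)
  also have "\<dots> \<le> (\<Sum>Z\<in>Zs. subset_weight E p Z * \<eta>)"
    using p sel bound unfolding Q_def N_def
    by (intro sum_mono mult_left_mono subset_weight_nonneg) auto
  also have "\<dots> \<le> (\<Sum>Z\<in>Pow E. subset_weight E p Z * \<eta>)"
    by (rule sum_mono2) (use finE p \<eta> in \<open>auto simp: Zs_def intro!: mult_nonneg_nonneg subset_weight_nonneg\<close>)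
  also have "\<dots> = \<eta>" using subset_exp_const[OF finE, of p \<eta>] by (simp add: subset_exp_def)
  finally show ?thesis .
qed

text \<open>The fragments may have different sizes. Weighting each by
  \<open>(1 / p) ^ card (F i)\<close> gives every one expectation 1, so that large fragments do not
  disappear from the count \<open>Y\<close>.\<close>

lemma second_moment_lower_bound:
  fixes F :: "'i \<Rightarrow> 'a set"
  assumes finE: "finite E" and finJ: "finite J" and J: "J \<noteq> {}" and FE: "\<And>i. i \<in> J \<Longrightarrow> F i \<subseteq> E"
    and p: "0 < p" "p \<le> 1" and \<delta>: "0 \<le> \<delta>"
    and bound: "\<And>i. i \<in> J \<Longrightarrow>
      (\<Sum>T\<in>Pow (F i) - {{}}. (1 / p) ^ card T * real (card {j\<in>J. T \<subseteq> F j})) \<le> \<delta> * real (card J)"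
  shows "1 / (1 + \<delta>) \<le> subset_exp E p (\<lambda>W. of_bool (\<exists>i\<in>J. F i \<subseteq> W))"
proof -
  define m where "m = real (card J)"
  have m: "m > 0" unfolding m_def using finJ J by (simp add: card_gt_0_iff)
  define Y where "Y W = (\<Sum>i\<in>J. (1 / p) ^ card (F i) * of_bool (F i \<subseteq> W))" for W
  have finF: "finite (F i)" if "i \<in> J" for i using FE[OF that] finE finite_subset by blast
  have EY: "subset_exp E p Y = m"
    unfolding Y_def subset_exp_sum subset_exp_cmult m_def
    using finE FE p by (simp add: subset_exp_superset power_divide)
  have "subset_exp E p (\<lambda>W. Y W * Y W)
      = (\<Sum>i\<in>J. \<Sum>j\<in>J. (1 / p) ^ card (F i) * (1 / p) ^ card (F j) * p ^ card (F i \<union> F j))"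
  proof -
    have "Y W * Y W = (\<Sum>i\<in>J. \<Sum>j\<in>J. (1 / p) ^ card (F i) * (1 / p) ^ card (F j) * of_bool (F i \<union> F j \<subseteq> W))" for W
      unfolding Y_def sum_product by (intro sum.cong refl) auto
    then have "subset_exp E p (\<lambda>W. Y W * Y W) = subset_exp E p (\<lambda>W. \<Sum>i\<in>J. \<Sum>j\<in>J.
        (1 / p) ^ card (F i) * (1 / p) ^ card (F j) * of_bool (F i \<union> F j \<subseteq> W))"
      by (simp only:)
    also have "\<dots> = (\<Sum>i\<in>J. \<Sum>j\<in>J. (1 / p) ^ card (F i) * (1 / p) ^ card (F j) * p ^ card (F i \<union> F j))"
      unfolding subset_exp_sum subset_exp_cmult
      by (intro sum.cong refl arg_cong2[where f = "(*)"] subset_exp_superset) (use finE FE in auto)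
    finally show ?thesis .
  qed
  also have "\<dots> = (\<Sum>i\<in>J. \<Sum>j\<in>J. (1 / p) ^ card (F i \<inter> F j))"
  proof (intro sum.cong refl)
    fix i j assume ij: "i \<in> J" "j \<in> J"
    have "card (F i) + card (F j) = card (F i \<union> F j) + card (F i \<inter> F j)"
      by (rule card_Un_Int) (use finF ij in auto)
    then have "(1 / p) ^ card (F i) * (1 / p) ^ card (F j) = (1 / p) ^ card (F i \<union> F j) * (1 / p) ^ card (F i \<inter> F j)"
      by (metis power_add)
    then show "(1 / p) ^ card (F i) * (1 / p) ^ card (F j) * p ^ card (F i \<union> F j) = (1 / p) ^ card (F i \<inter> F j)"
      using p by (simp add: power_divide)
  qed
  also have "\<dots> \<le> (\<Sum>i\<in>J. m + \<delta> * m)"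
  proof (rule sum_mono)
    fix i assume i: "i \<in> J"
    \<comment> \<open>The indices \<open>j\<close> are sorted by the exact intersection with
      \<open>F i\<close>. The empty intersection contributes at most \<open>m\<close>; for the
      others exact equality is relaxed to containment, which the hypothesis bounds.\<close>
    have "(\<Sum>j\<in>J. (1 / p) ^ card (F i \<inter> F j))
        = (\<Sum>T\<in>Pow (F i). \<Sum>j\<in>{j\<in>J. F i \<inter> F j = T}. (1 / p) ^ card (F i \<inter> F j))"
      by (rule sum.group[symmetric]) (use finJ finF i in auto)
    also have "\<dots> = (\<Sum>T\<in>Pow (F i). (1 / p) ^ card T * real (card {j\<in>J. F i \<inter> F j = T}))"
      by (intro sum.cong refl) (simp add: mult.commute)
    also have "\<dots> = (1 / p) ^ card ({}::'a set) * real (card {j\<in>J. F i \<inter> F j = {}})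
        + (\<Sum>T\<in>Pow (F i) - {{}}. (1 / p) ^ card T * real (card {j\<in>J. F i \<inter> F j = T}))"
      by (rule sum.remove) (use finF i in auto)
    also have "\<dots> \<le> m + (\<Sum>T\<in>Pow (F i) - {{}}. (1 / p) ^ card T * real (card {j\<in>J. T \<subseteq> F j}))"
    proof (intro add_mono sum_mono mult_left_mono)
      show "(1 / p) ^ card ({}::'a set) * real (card {j\<in>J. F i \<inter> F j = {}}) \<le> m"
        unfolding m_def using finJ by (simp add: card_mono)
      show "real (card {j\<in>J. F i \<inter> F j = T}) \<le> real (card {j\<in>J. T \<subseteq> F j})" for T
        using finJ by (intro of_nat_mono card_mono) auto
    qed (use p in auto)
    also have "\<dots> \<le> m + \<delta> * m" using bound[OF i] unfolding m_def by simp
    finally show "(\<Sum>j\<in>J. (1 / p) ^ card (F i \<inter> F j)) \<le> m + \<delta> * m" .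
  qed
  also have "\<dots> = m\<^sup>2 * (1 + \<delta>)" unfolding m_def by (simp add: power2_eq_square algebra_simps)
  finally have EY2: "subset_exp E p (\<lambda>W. Y W * Y W) \<le> m\<^sup>2 * (1 + \<delta>)" .
  \<comment> \<open>Cauchy-Schwarz in linear form: \<open>1 - (1 - a * Y)^2\<close> lies below the
    indicator of \<open>Y > 0\<close>, and this \<open>a\<close> maximises
    \<open>2 * a * m - a^2 * m^2 * (1 + \<delta>)\<close>.\<close>
  define a where "a = 1 / (m * (1 + \<delta>))"
  have "2 * a * Y W - a\<^sup>2 * (Y W * Y W) \<le> of_bool (\<exists>i\<in>J. F i \<subseteq> W)" for W
  proof (cases "\<exists>i\<in>J. F i \<subseteq> W")
    case True
    have "0 \<le> (1 - a * Y W)\<^sup>2" by simp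
    then show ?thesis using True by (simp add: power2_eq_square algebra_simps)
  next
    case False
    then have "Y W = 0" unfolding Y_def by (intro sum.neutral) auto
    then show ?thesis using False by simp
  qed
  then have "subset_exp E p (\<lambda>W. 2 * a * Y W - a\<^sup>2 * (Y W * Y W)) \<le> subset_exp E p (\<lambda>W. of_bool (\<exists>i\<in>J. F i \<subseteq> W))"
    by (intro subset_exp_mono) (use p in auto)
  then have "2 * a * m - a\<^sup>2 * subset_exp E p (\<lambda>W. Y W * Y W) \<le> subset_exp E p (\<lambda>W. of_bool (\<exists>i\<in>J. F i \<subseteq> W))"
    by (simp add: subset_exp_diff subset_exp_cmult EY)
  moreover have "a\<^sup>2 * subset_exp E p (\<lambda>W. Y W * Y W) \<le> a\<^sup>2 * (m\<^sup>2 * (1 + \<delta>))"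
    by (intro mult_left_mono EY2) auto
  moreover have "2 * a * m - a\<^sup>2 * (m\<^sup>2 * (1 + \<delta>)) = 1 / (1 + \<delta>)"
    using m \<delta> by (simp add: a_def power2_eq_square divide_simps)
  ultimately show ?thesis by linarith
qed

text \<open>If fewer than half of the copies are bad after the first round, the remaining index set
  has at least half the size of \<open>I\<close>, which costs the factor 2 in
  \<open>\<delta>\<close>. The bound used for each \<open>W\<close> is linear in the number of bad
  copies and nonpositive once half are bad, so its expectation needs only the expected number of bad
  copies; this costs the factor 2 in \<open>\<eta>\<close>.\<close>

lemma two_round_lower_bound:
  fixes S :: "'i \<Rightarrow> 'a set" and t :: real
  assumes finE: "finite E" and finI: "finite I" and I: "I \<noteq> {}" and SE: "\<And>i. i \<in> I \<Longrightarrow> S i \<subseteq> E"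
    and p: "0 < p" "2 * p \<le> 1" and \<eta>: "0 \<le> \<eta>" and \<delta>: "0 \<le> \<delta>"
    and large: "\<And>i. i \<in> I \<Longrightarrow>
      (\<Sum>T\<in>{T. T \<subseteq> S i \<and> t \<le> real (card T)}. (1 / p) ^ card T * real (card {j\<in>I. T \<subseteq> S j}))
        \<le> \<eta> * real (card I)"
    and small: "\<And>i F. i \<in> I \<Longrightarrow> F \<subseteq> S i \<Longrightarrow> real (card F) < t \<Longrightarrow>
      (\<Sum>T\<in>Pow F - {{}}. (1 / p) ^ card T * real (card {j\<in>I. T \<subseteq> S j})) \<le> \<delta> * real (card I)"
  shows "(1 - 2 * \<eta>) / (1 + 2 * \<delta>) \<le> subset_exp E (2 * p) (\<lambda>W. of_bool (\<exists>i\<in>I. S i \<subseteq> W))"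
proof -
  define m where "m = real (card I)"
  have m: "m > 0" unfolding m_def using finI I by (simp add: card_gt_0_iff)
  define bad where "bad W = {i\<in>I. \<not> (\<exists>j\<in>I. S j \<subseteq> W \<union> S i \<and> real (card (S j - W)) < t)}" for W
  have Ebad: "subset_exp E p (\<lambda>W. real (card (bad W))) \<le> \<eta> * m"
    unfolding bad_def m_def
    by (rule expected_large_fragments_le) (use assms in auto)
  have round2: "(1 - 2 / m * real (card (bad W))) / (1 + 2 * \<delta>)
      \<le> subset_exp E p (\<lambda>W'. of_bool (\<exists>i\<in>I. S i \<subseteq> W \<union> W'))" if W: "W \<subseteq> E" for W
  proof (cases "2 * real (card (bad W)) < m")
    case False
    then have "(1 - 2 / m * real (card (bad W))) / (1 + 2 * \<delta>) \<le> 0"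
      using m \<delta> by (intro divide_nonpos_nonneg) (auto simp: field_simps)
    also have "0 = subset_exp E p (\<lambda>_. 0)" using finE by (simp add: subset_exp_const)
    also have "\<dots> \<le> subset_exp E p (\<lambda>W'. of_bool (\<exists>i\<in>I. S i \<subseteq> W \<union> W'))"
      by (rule subset_exp_mono) (use p in auto)
    finally show ?thesis .
  next
    case True
    define J where "J = I - bad W"
    have badI: "bad W \<subseteq> I" unfolding bad_def by auto
    have cJ: "real (card J) = m - real (card (bad W))"
      unfolding J_def m_def using badI finI
      by (simp add: card_Diff_subset finite_subset card_mono of_nat_diff)
    then have cJ2: "m \<le> 2 * real (card J)" using True by simp
    have "\<forall>i\<in>J. \<exists>j\<in>I. S j \<subseteq> W \<union> S i \<and> real (card (S j - W)) < t"
      unfolding J_def bad_def by auto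
    then obtain g where g: "\<And>i. i \<in> J \<Longrightarrow> g i \<in> I \<and> S (g i) \<subseteq> W \<union> S i \<and> real (card (S (g i) - W)) < t"
      by metis
    \<comment> \<open>The fragment is cut from the copy \<open>g i\<close> but lies inside
      \<open>S i\<close>. The first fact makes \<open>W \<union> W'\<close> contain a whole copy;
      the second lets the counts for \<open>F\<close> be bounded by those for
      \<open>S\<close>.\<close>
    define F where "F i = S (g i) - W" for i
    have FS: "F i \<subseteq> S i" "real (card (F i)) < t" if "i \<in> J" for i
      using g[OF that] unfolding F_def by auto
    have "1 / (1 + 2 * \<delta>) \<le> subset_exp E p (\<lambda>W'. of_bool (\<exists>i\<in>J. F i \<subseteq> W'))"
    proof (rule second_moment_lower_bound)
      show "finite J" unfolding J_def using finI by auto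
      show "J \<noteq> {}" using cJ2 m by auto
      show "F i \<subseteq> E" if "i \<in> J" for i using FS[OF that] SE[of i] that unfolding J_def by auto
      fix i assume i: "i \<in> J"
      have "(\<Sum>T\<in>Pow (F i) - {{}}. (1 / p) ^ card T * real (card {j\<in>J. T \<subseteq> F j}))
          \<le> (\<Sum>T\<in>Pow (F i) - {{}}. (1 / p) ^ card T * real (card {j\<in>I. T \<subseteq> S j}))"
      proof (intro sum_mono mult_left_mono of_nat_mono card_mono)
        show "{j\<in>J. T \<subseteq> F j} \<subseteq> {j\<in>I. T \<subseteq> S j}" for T using FS unfolding J_def by blast
      qed (use p finI in auto)
      also have "\<dots> \<le> \<delta> * m" unfolding m_def by (rule small) (use i FS in \<open>auto simp: J_def\<close>)
      also have "\<dots> \<le> 2 * \<delta> * real (card J)" using mult_left_mono[OF cJ2 \<delta>] by simp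
      finally show "(\<Sum>T\<in>Pow (F i) - {{}}. (1 / p) ^ card T * real (card {j\<in>J. T \<subseteq> F j})) \<le> 2 * \<delta> * real (card J)" .
    qed (use finE p \<delta> in auto)
    also have "\<dots> \<le> subset_exp E p (\<lambda>W'. of_bool (\<exists>i\<in>I. S i \<subseteq> W \<union> W'))"
    proof (rule subset_exp_mono)
      fix W'
      have "\<exists>i\<in>I. S i \<subseteq> W \<union> W'" if "\<exists>i\<in>J. F i \<subseteq> W'"
        using that g unfolding F_def by blast
      then show "(of_bool (\<exists>i\<in>J. F i \<subseteq> W') :: real) \<le> of_bool (\<exists>i\<in>I. S i \<subseteq> W \<union> W')" by auto
    qed (use p in auto)
    finally have "1 / (1 + 2 * \<delta>) \<le> subset_exp E p (\<lambda>W'. of_bool (\<exists>i\<in>I. S i \<subseteq> W \<union> W'))" .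
    moreover have "(1 - 2 / m * real (card (bad W))) / (1 + 2 * \<delta>) \<le> 1 / (1 + 2 * \<delta>)"
      using m \<delta> by (intro divide_right_mono) auto
    ultimately show ?thesis by linarith
  qed
  have "(1 - 2 * \<eta>) / (1 + 2 * \<delta>) \<le> (1 - 2 / m * subset_exp E p (\<lambda>W. real (card (bad W)))) / (1 + 2 * \<delta>)"
    using Ebad m \<delta> by (intro divide_right_mono) (auto simp: field_simps)
  also have "\<dots> = subset_exp E p (\<lambda>W. (1 - 2 / m * real (card (bad W))) / (1 + 2 * \<delta>))"
  proof -
    have "subset_exp E p (\<lambda>W. (1 - 2 / m * real (card (bad W))) / (1 + 2 * \<delta>))
        = subset_exp E p (\<lambda>W. 1 / (1 + 2 * \<delta>) * (1 - 2 / m * real (card (bad W))))" by simp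
    also have "\<dots> = 1 / (1 + 2 * \<delta>) * (1 - 2 / m * subset_exp E p (\<lambda>W. real (card (bad W))))"
      unfolding subset_exp_cmult subset_exp_diff using finE by (simp add: subset_exp_const)
    finally show ?thesis by simp
  qed
  also have "\<dots> \<le> subset_exp E p (\<lambda>W. subset_exp E p (\<lambda>W'. of_bool (\<exists>i\<in>I. S i \<subseteq> W \<union> W')))"
    by (rule subset_exp_mono) (use p round2 in auto)
  also have "\<dots> \<le> subset_exp E (2 * p) (\<lambda>W. of_bool (\<exists>i\<in>I. S i \<subseteq> W))"
    by (rule subset_exp_union_le[where f = "\<lambda>W. of_bool (\<exists>i\<in>I. S i \<subseteq> W)"])
       (use finE p in \<open>auto simp: of_bool_def, blast?\<close>)
  finally show ?thesis .
qed

subsection \<open>Components and homomorphism counts\<close>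

text \<open>Connectedness phrased by cuts instead of paths. A crossing edge is exactly what is used
  later, both to list the vertices one neighbour at a time and to show that a component skips no
  block.\<close>

definition cut_connected :: "'a set set \<Rightarrow> 'a set \<Rightarrow> bool" where
  "cut_connected T U \<longleftrightarrow> (\<forall>X\<subseteq>U. X \<noteq> {} \<longrightarrow> X \<noteq> U \<longrightarrow> (\<exists>a\<in>X. \<exists>b\<in>U - X. {a, b} \<in> T))"

text \<open>Components are built edge by edge: a new edge is merged with all parts that it meets. A
  set that no edge crosses splits neither an old part nor the new edge, and the new edge meets every
  merged part. Parts have at least two vertices, as the density bound requires.\<close>

lemma connected_partition_exists:
  assumes "finite T" "\<And>e. e \<in> T \<Longrightarrow> card e = 2"
  shows "\<exists>P. finite P \<and> disjoint P \<and> \<Union>P = \<Union>T \<and> (\<forall>e\<in>T. \<exists>U\<in>P. e \<subseteq> U)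
           \<and> (\<forall>U\<in>P. cut_connected T U \<and> finite U \<and> 2 \<le> card U)"
  using assms
proof (induction T rule: finite_induct)
  case empty
  then show ?case by (intro exI[of _ "{}"]) auto
next
  case (insert e T)
  obtain P where P: "finite P" "disjoint P" "\<Union>P = \<Union>T" "\<forall>e\<in>T. \<exists>U\<in>P. e \<subseteq> U"
      "\<forall>U\<in>P. cut_connected T U \<and> finite U \<and> 2 \<le> card U"
    using insert by (metis insertCI)
  obtain a b where e: "e = {a, b}" "a \<noteq> b" using insert.prems[of e] by (auto simp: card_2_iff)
  define Q where "Q = {U\<in>P. U \<inter> e \<noteq> {}}"
  define M where "M = e \<union> \<Union>Q"
  have finM: "finite M" unfolding M_def Q_def using P e by auto
  have conn: "cut_connected (insert e T) M"
    unfolding cut_connected_def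
  proof (intro allI impI)
    fix X assume X: "X \<subseteq> M" "X \<noteq> {}" "X \<noteq> M"
    show "\<exists>c\<in>X. \<exists>d\<in>M - X. {c, d} \<in> insert e T"
    proof (rule ccontr)
      assume no: "\<not> (\<exists>c\<in>X. \<exists>d\<in>M - X. {c, d} \<in> insert e T)"
      have Q: "X \<inter> U = {} \<or> U \<subseteq> X" if U: "U \<in> Q" for U
      proof (rule ccontr)
        assume "\<not> (X \<inter> U = {} \<or> U \<subseteq> X)"
        then have "X \<inter> U \<subseteq> U" "X \<inter> U \<noteq> {}" "X \<inter> U \<noteq> U" by auto
        moreover have "cut_connected T U" using P(5) U unfolding Q_def by auto
        ultimately obtain c d where "c \<in> X \<inter> U" "d \<in> U - X \<inter> U" "{c, d} \<in> T"
          unfolding cut_connected_def by meson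
        then show False using no U unfolding M_def by auto
      qed
      have ab: "a \<in> X \<longleftrightarrow> b \<in> X"
        using no e unfolding M_def by (auto simp: insert_commute)
      show False
      proof (cases "a \<in> X")
        case True
        then have "e \<subseteq> X" using ab e by auto
        then have "U \<subseteq> X" if "U \<in> Q" for U using Q[OF that] that unfolding Q_def by auto
        then show False using X \<open>e \<subseteq> X\<close> unfolding M_def by auto
      next
        case False
        then have "e \<inter> X = {}" using ab e by auto
        moreover have "X \<inter> U = {}" if "U \<in> Q" for U
          using Q[OF that] that \<open>e \<inter> X = {}\<close> unfolding Q_def by auto
        ultimately have "X \<inter> M = {}" unfolding M_def by blast
        then show False using X by blast
      qed
    qed
  qed
  have mono: "cut_connected (insert e T) U" if "cut_connected T U" for U
    using that unfolding cut_connected_def by blast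
  have "2 \<le> card M"
    using card_mono[OF finM, of e] e unfolding M_def by auto
  then have cU: "\<forall>U\<in>insert M (P - Q). cut_connected (insert e T) U \<and> finite U \<and> 2 \<le> card U"
    using conn finM P(5) mono by auto
  have "disjnt M U" if "U \<in> P - Q" for U
    using that P(2) unfolding M_def Q_def disjnt_def pairwise_def by blast
  then have "disjoint (insert M (P - Q))"
    using P(2) by (auto simp: pairwise_insert disjnt_sym intro: pairwise_subset)
  moreover have "\<Union>(insert M (P - Q)) = \<Union>(insert e T)"
    using P(3) unfolding M_def Q_def by auto
  moreover have "\<forall>f\<in>insert e T. \<exists>U\<in>insert M (P - Q). f \<subseteq> U"
  proof
    fix f assume "f \<in> insert e T"
    show "\<exists>U\<in>insert M (P - Q). f \<subseteq> U"
    proof (cases "f = e")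
      case True
      then show ?thesis unfolding M_def by auto
    next
      case False
      then obtain U where "U \<in> P" "f \<subseteq> U" using P(4) \<open>f \<in> insert e T\<close> by auto
      then show ?thesis unfolding M_def by (cases "U \<in> Q") auto
    qed
  qed
  ultimately show ?case using cU P(1) by (intro exI[of _ "insert M (P - Q)"]) auto
qed

text \<open>\<open>grown T A k\<close>: the vertices of \<open>A\<close> can be listed so that all but \<open>k\<close> of them have a
  \<open>T\<close>-neighbour that comes earlier.\<close>

inductive grown :: "'a set set \<Rightarrow> 'a set \<Rightarrow> nat \<Rightarrow> bool" for T where
  grown_empty: "grown T {} 0"
| grown_root: "grown T A k \<Longrightarrow> v \<notin> A \<Longrightarrow> grown T (insert v A) (Suc k)"
| grown_step: "grown T A k \<Longrightarrow> v \<notin> A \<Longrightarrow> u \<in> A \<Longrightarrow> {u, v} \<in> T \<Longrightarrow> grown T (insert v A) k"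

lemma grown_finite: "grown T A k \<Longrightarrow> finite A"
  by (induction rule: grown.induct) auto

lemma grown_le_card: "grown T A k \<Longrightarrow> k \<le> card A"
  by (induction rule: grown.induct) (auto simp: card_insert_if dest: grown_finite)

lemma grown_extend_within:
  assumes "finite U" "cut_connected T U" "A \<inter> U = {}" "X \<subseteq> U" "X \<noteq> {}" "grown T (A \<union> X) k"
  shows "grown T (A \<union> U) k"
  using assms(4-6)
proof (induction "card (U - X)" arbitrary: X)
  case 0
  then have "X = U" using assms(1) by auto
  then show ?case using 0 by simp
next
  case (Suc m)
  then have "X \<noteq> U" by auto
  then obtain a b where ab: "a \<in> X" "b \<in> U - X" "{a, b} \<in> T"
    using assms(2) Suc.prems unfolding cut_connected_def by meson
  have "grown T (insert b (A \<union> X)) k"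
    by (rule grown_step[of T _ k b a]) (use Suc.prems ab assms in auto)
  then have "grown T (A \<union> insert b X) k" by simp
  moreover have "m = card (U - insert b X)"
  proof -
    have "U - insert b X = (U - X) - {b}" by auto
    then have "card (U - insert b X) = card (U - X) - 1" using ab by simp
    then show ?thesis using Suc.hyps(2) by simp
  qed
  moreover have "insert b X \<subseteq> U" "insert b X \<noteq> {}" using Suc.prems(1) ab by auto
  ultimately show ?case by (intro Suc.hyps(1))
qed

lemma grown_Union_partition:
  assumes "finite P" "disjoint P" "\<And>U. U \<in> P \<Longrightarrow> cut_connected T U \<and> finite U \<and> U \<noteq> {}"
  shows "grown T (\<Union>P) (card P)"
  using assms
proof (induction P rule: finite_induct)
  case empty
  then show ?case by (simp add: grown_empty)
next
  case (insert U P)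
  have IH: "grown T (\<Union>P) (card P)"
    using insert.prems by (intro insert.IH) (auto simp: pairwise_insert)
  have dis: "\<Union>P \<inter> U = {}"
    using insert.prems(1) insert.hyps(2) by (auto simp: pairwise_insert disjnt_def)
  have U: "cut_connected T U" "finite U" "U \<noteq> {}" using insert.prems(2) by auto
  then obtain u where u: "u \<in> U" by auto
  have "grown T (\<Union>P \<union> U) (Suc (card P))"
  proof (rule grown_extend_within[where X = "{u}"])
    have "grown T (insert u (\<Union>P)) (Suc (card P))"
      by (rule grown_root[OF IH]) (use dis u in auto)
    then show "grown T (\<Union>P \<union> {u}) (Suc (card P))" by simp
  qed (use U dis u in auto)
  then show ?case using insert.hyps by (simp add: Un_commute)
qed

section \<open>Homomorphisms into graphs of bounded degree\<close>

lemma inj_on_restrict_insert: "inj_on (\<lambda>\<phi>. (restrict \<phi> A, \<phi> v)) (insert v A \<rightarrow>\<^sub>E X)"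
proof (rule inj_onI)
  fix \<phi> \<psi> assume *: "\<phi> \<in> insert v A \<rightarrow>\<^sub>E X" "\<psi> \<in> insert v A \<rightarrow>\<^sub>E X"
    "(restrict \<phi> A, \<phi> v) = (restrict \<psi> A, \<psi> v)"
  show "\<phi> = \<psi>"
  proof (rule PiE_ext[OF *(1,2)])
    fix x assume "x \<in> insert v A"
    then show "\<phi> x = \<psi> x" using *(3) by (metis insertE prod.inject restrict_apply')
  qed
qed

text \<open>Images are chosen in the order given by \<open>grown\<close>: a root is free, while any
  other vertex must go to one of at most \<open>d\<close> neighbours of an image already
  chosen.\<close>

lemma card_homs_le:
  assumes "grown T A k" "finite X" "\<And>x. x \<in> X \<Longrightarrow> card {y\<in>X. {x, y} \<in> G} \<le> d"
  shows "card {\<phi> \<in> A \<rightarrow>\<^sub>E X. \<forall>a\<in>A. \<forall>b\<in>A. {a, b} \<in> T \<longrightarrow> {\<phi> a, \<phi> b} \<in> G} \<le> card X ^ k * d ^ (card A - k)"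
  using assms(1)
proof (induction rule: grown.induct)
  case grown_empty
  then show ?case by (auto intro: order_trans[OF card_mono[of "{\<lambda>x. undefined}"]])
next
  case (grown_root A k v)
  let ?H = "\<lambda>A. {\<phi> \<in> A \<rightarrow>\<^sub>E X. \<forall>a\<in>A. \<forall>b\<in>A. {a, b} \<in> T \<longrightarrow> {\<phi> a, \<phi> b} \<in> G}"
  have fA: "finite A" using grown_root grown_finite by blast
  have fH: "finite (?H A)"
    by (rule finite_subset[of _ "A \<rightarrow>\<^sub>E X"]) (use fA assms in \<open>auto intro: finite_PiE\<close>)
  define h where "h \<phi> = (restrict \<phi> A, \<phi> v)" for \<phi> :: "'a \<Rightarrow> 'b"
  have inj: "inj_on h (?H (insert v A))"
    unfolding h_def by (rule inj_on_subset[OF inj_on_restrict_insert[of A v X]]) auto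
  have sub: "h ` ?H (insert v A) \<subseteq> ?H A \<times> X" unfolding h_def by auto
  have "card (?H (insert v A)) \<le> card (?H A \<times> X)"
    using card_image[OF inj] card_mono[OF _ sub] fH assms(2) by simp
  also have "\<dots> = card (?H A) * card X" by (simp add: card_cartesian_product)
  also have "\<dots> \<le> card X ^ k * d ^ (card A - k) * card X"
    using grown_root.IH by (intro mult_right_mono) auto
  finally show ?case using fA grown_root by (simp add: mult_ac)
next
  case (grown_step A k v u)
  let ?H = "\<lambda>A. {\<phi> \<in> A \<rightarrow>\<^sub>E X. \<forall>a\<in>A. \<forall>b\<in>A. {a, b} \<in> T \<longrightarrow> {\<phi> a, \<phi> b} \<in> G}"
  have fA: "finite A" using grown_step grown_finite by blast
  have fH: "finite (?H A)"
    by (rule finite_subset[of _ "A \<rightarrow>\<^sub>E X"]) (use fA assms in \<open>auto intro: finite_PiE\<close>)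
  define h where "h \<phi> = (restrict \<phi> A, \<phi> v)" for \<phi> :: "'a \<Rightarrow> 'b"
  have inj: "inj_on h (?H (insert v A))"
    unfolding h_def by (rule inj_on_subset[OF inj_on_restrict_insert[of A v X]]) auto
  have sub: "h ` ?H (insert v A) \<subseteq> (SIGMA \<phi>:?H A. {y\<in>X. {\<phi> u, y} \<in> G})"
    unfolding h_def using grown_step by auto
  have fin: "finite (SIGMA \<phi>:?H A. {y\<in>X. {\<phi> u, y} \<in> G})" using fH assms(2) by auto
  have "card (?H (insert v A)) \<le> card (SIGMA \<phi>:?H A. {y\<in>X. {\<phi> u, y} \<in> G})"
    using card_image[OF inj] card_mono[OF fin sub] by simp
  also have "\<dots> = (\<Sum>\<phi>\<in>?H A. card {y\<in>X. {\<phi> u, y} \<in> G})" by (simp add: card_SigmaI fH assms(2))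
  also have "\<dots> \<le> (\<Sum>\<phi>\<in>?H A. d)"
    by (intro sum_mono assms(3)) (use grown_step in auto)
  also have "\<dots> = card (?H A) * d" by simp
  also have "\<dots> \<le> card X ^ k * d ^ (card A - k) * d"
    using grown_step.IH by (intro mult_right_mono) auto
  also have "\<dots> = card X ^ k * d ^ (card (insert v A) - k)"
    using fA grown_step grown_le_card[OF grown_step(1)] by (simp add: Suc_diff_le mult_ac)
  finally show ?case .
qed

subsection \<open>Density of clique chains\<close>

text \<open>The number of maximal intervals of consecutive integers in \<open>B\<close>, counted by
  their left ends.\<close>

definition runs :: "nat set \<Rightarrow> nat" where
  "runs B = card {i\<in>B. \<forall>j\<in>B. Suc j \<noteq> i}"

text \<open>The cycle cut open: consecutive cliques still share two vertices, but nothing wraps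
  around modulo \<open>n\<close>.\<close>

definition clique_chain :: "nat \<Rightarrow> nat \<Rightarrow> nat set set" where
  "clique_chain r k = (\<Union>i<k. nsets {i * (r - 2)..<i * (r - 2) + r} 2)"

lemma finite_clique_chain: "finite (clique_chain r k)"
  unfolding clique_chain_def by (auto intro: finite_imp_finite_nsets)

lemma clique_chain_Suc:
  "clique_chain r (Suc k) = clique_chain r k \<union> nsets {k * (r - 2)..<k * (r - 2) + r} 2"
  unfolding clique_chain_def by (auto simp: lessThan_Suc)

lemma clique_chain_card_edge: "e \<in> clique_chain r k \<Longrightarrow> card e = 2"
  unfolding clique_chain_def by (auto simp: nsets_def)

lemma clique_chain_edge_less: "{a, b} \<in> clique_chain r k \<Longrightarrow> b < a + r"
  unfolding clique_chain_def by auto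

lemma clique_chain_edge_bound:
  assumes "2 \<le> r" "e \<in> clique_chain r k"
  shows "e \<subseteq> {..<k * (r - 2) + 2}"
proof -
  obtain i where i: "i < k" "e \<subseteq> {i * (r - 2)..<i * (r - 2) + r}"
    using assms(2) unfolding clique_chain_def by (auto simp: nsets_def)
  have "Suc i * (r - 2) \<le> k * (r - 2)" using i by (intro mult_right_mono) auto
  then have "i * (r - 2) + r \<le> k * (r - 2) + 2" using assms(1) by simp
  then show ?thesis using i by auto
qed

lemma double_choose_two: "2 * (m choose 2) = m * (m - 1)"
  by (cases m) (simp_all add: choose_two)

text \<open>A further clique shares only the edge \<open>{s, s + 1}\<close> with the earlier ones,
  so it brings at least \<open>(r choose 2) - 1 = (r - 2) * (r + 1) / 2\<close> new edges for
  \<open>r - 2\<close> new vertices. The ratio \<open>(r + 1) / 2\<close> is the reciprocal of the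
  exponent in the threshold.\<close>

lemma clique_chain_card_ge:
  assumes "3 \<le> r"
  shows "k * ((r - 2) * (r + 1)) \<le> 2 * card (clique_chain r k)"
proof (induction k)
  case (Suc k)
  define s where "s = k * (r - 2)"
  define N where "N = nsets {s..<s + r} 2 - {{s, s + 1}}"
  have finN: "finite N" unfolding N_def by (simp add: finite_imp_finite_nsets)
  have dis: "clique_chain r k \<inter> N = {}"
  proof -
    have "e \<notin> N" if "e \<in> clique_chain r k" for e
    proof
      assume N: "e \<in> N"
      then obtain a b where e: "e = {a, b}" "a < b" "s \<le> a"
        unfolding N_def by (auto simp: ordered_nsets_2_eq)
      have "e \<subseteq> {..<s + 2}" using clique_chain_edge_bound[OF _ that] assms unfolding s_def by auto
      then have "a = s" "b = s + 1" using e by auto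
      then show False using N e unfolding N_def by auto
    qed
    then show ?thesis by auto
  qed
  have "{s, s + 1} \<in> nsets {s..<s + r} 2" using assms by simp
  then have "card N = (r choose 2) - 1"
    unfolding N_def by (simp add: card_nsets finite_imp_finite_nsets)
  moreover have "0 < r choose 2" using assms by (simp add: zero_less_binomial)
  ultimately have "card N + 1 = r choose 2" by linarith
  then have "2 * card N + 2 = r * (r - 1)" using double_choose_two[of r] by linarith
  moreover have "(r - 2) * (r + 1) + 2 = r * (r - 1)"
    using le_Suc_ex[OF assms] by (auto simp: algebra_simps)
  ultimately have cN: "2 * card N = (r - 2) * (r + 1)" by simp
  have "clique_chain r k \<union> N \<subseteq> clique_chain r (Suc k)"
    unfolding clique_chain_Suc N_def s_def by auto
  then have "card (clique_chain r k) + card N \<le> card (clique_chain r (Suc k))"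
    using card_mono[OF finite_clique_chain] card_Un_disjoint[OF finite_clique_chain finN dis] by metis
  then show ?case using Suc cN by simp
qed simp

text \<open>Cliques have density \<open>((h choose 2) - 1) / (h - 2) = (h + 1) / 2\<close> relative to an edge, which is
  at most \<open>(r + 1) / 2\<close> for \<open>h \<le> r\<close>; the bound survives gluing along edges.\<close>

lemma clique_chain_density:
  assumes r: "3 \<le> r" and "finite U" "2 \<le> card U"
  shows "2 * card {e\<in>clique_chain r k. e \<subseteq> U} + 2 * r \<le> (r + 1) * card U"
  using assms(2,3)
proof (induction k arbitrary: U)
  case 0
  then have "(r + 1) * 2 \<le> (r + 1) * card U" by (intro mult_left_mono) auto
  then show ?case by (simp add: clique_chain_def)
next
  case (Suc k)
  define s where "s = k * (r - 2)"
  define A where "A = {e\<in>clique_chain r k. e \<subseteq> U}"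
  define U' where "U' = U \<inter> {..<s + 2}"
  define W where "W = U \<inter> {s + 2..<s + r}"
  have finA: "finite A" unfolding A_def using finite_clique_chain by auto
  have fin: "finite U'" "finite W" unfolding U'_def W_def using Suc by auto
  have A_eq: "A = {e\<in>clique_chain r k. e \<subseteq> U'}"
    unfolding A_def U'_def s_def using clique_chain_edge_bound[of r _ k] r by auto
  have split: "{e\<in>clique_chain r (Suc k). e \<subseteq> U} = A \<union> nsets (U \<inter> {s..<s + r}) 2"
    unfolding A_def clique_chain_Suc s_def by (auto simp: nsets_def)
  show ?case
  \<comment> \<open>With fewer than two vertices below \<open>s + 2\<close>, no edge of the earlier
    cliques lies in \<open>U\<close>, and one clique remains. The condition \<open>0 < k\<close> is
    there because for \<open>k = 0\<close> the shared edge \<open>{s, s + 1}\<close> is not yet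
    present.\<close>
  proof (cases "0 < k \<and> 2 \<le> card U'")
    case True
    then have IH: "2 * card A + 2 * r \<le> (r + 1) * card U'"
      unfolding A_eq using Suc.IH[of U'] fin by simp
    define D where "D = U \<inter> {s, s + 1}"
    \<comment> \<open>The edge \<open>{s, s + 1}\<close> already belongs to the preceding clique, so
      each genuinely new edge has an end in \<open>W\<close>.\<close>
    have "A \<union> nsets (U \<inter> {s..<s + r}) 2 \<subseteq> A \<union> (nsets W 2 \<union> (\<lambda>(d, w). {d, w}) ` (D \<times> W))"
    proof
      fix e assume "e \<in> A \<union> nsets (U \<inter> {s..<s + r}) 2"
      then show "e \<in> A \<union> (nsets W 2 \<union> (\<lambda>(d, w). {d, w}) ` (D \<times> W))"
      proof
        assume e: "e \<in> nsets (U \<inter> {s..<s + r}) 2"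
        then obtain a b where ab: "e = {a, b}" "a < b" "a \<in> U" "b \<in> U" "s \<le> a" "b < s + r"
          by (auto simp: ordered_nsets_2_eq)
        show ?thesis
        proof (cases "b < s + 2")
          case True
          then have "a = s" "b = s + 1" using ab by auto
          moreover have "{s, s + 1} \<in> clique_chain r k"
          proof -
            obtain k' where k': "k = Suc k'" using \<open>0 < k \<and> 2 \<le> card U'\<close> gr0_conv_Suc by auto
            have "k' * (r - 2) \<le> s" "s + 2 = k' * (r - 2) + r" unfolding s_def k' using r by auto
            then show ?thesis unfolding k' clique_chain_Suc by auto
          qed
          ultimately show ?thesis using ab unfolding A_def by auto
        next
          case False
          then show ?thesis using ab unfolding W_def D_def by (cases "a < s + 2") auto
        qed
      qed auto
    qed
    then have "card {e\<in>clique_chain r (Suc k). e \<subseteq> U} \<le> card (A \<union> (nsets W 2 \<union> (\<lambda>(d, w). {d, w}) ` (D \<times> W)))"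
      unfolding split by (rule card_mono[rotated]) (use finA fin in \<open>auto simp: D_def finite_imp_finite_nsets\<close>)
    also have "\<dots> \<le> card A + (card (nsets W 2) + card ((\<lambda>(d, w). {d, w}) ` (D \<times> W)))"
      by (meson add_left_mono card_Un_le order_trans)
    also have "card (nsets W 2) = card W choose 2" by (rule card_nsets)
    also have "card ((\<lambda>(d, w). {d, w}) ` (D \<times> W)) \<le> 2 * card W"
    proof -
      have "card ((\<lambda>(d, w). {d, w}) ` (D \<times> W)) \<le> card (D \<times> W)"
        by (rule card_image_le) (use fin in \<open>auto simp: D_def\<close>)
      also have "\<dots> = card D * card W" by (rule card_cartesian_product)
      also have "card D \<le> card {s, s + 1}" unfolding D_def by (intro card_mono) auto
      then have "card D * card W \<le> 2 * card W" by (intro mult_right_mono) auto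
      finally show ?thesis .
    qed
    finally have "2 * card {e\<in>clique_chain r (Suc k). e \<subseteq> U} \<le> 2 * card A + card W * (card W - 1) + 4 * card W"
      using double_choose_two[of "card W"] by simp
    \<comment> \<open>For \<open>w = card W\<close> this is
      \<open>w * (w - 1) + 4 * w = w * (w + 3)\<close>, and \<open>w <= r - 2\<close> gives the
      slope \<open>r + 1\<close>.\<close>
    also have "\<dots> \<le> 2 * card A + card W * (card W + 3)"
      by (cases "card W") (auto simp: algebra_simps)
    also have "\<dots> \<le> 2 * card A + card W * (r + 1)"
    proof -
      have "card W \<le> card {s + 2..<s + r}" unfolding W_def by (intro card_mono) auto
      then have "card W + 3 \<le> r + 1" using r by simp
      then show ?thesis by (intro add_left_mono mult_left_mono) auto
    qed
    finally have "2 * card {e\<in>clique_chain r (Suc k). e \<subseteq> U} + 2 * r \<le> (r + 1) * (card U' + card W)"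
      using IH by (simp add: algebra_simps)
    moreover have "card U' + card W \<le> card U"
    proof -
      have "card (U' \<union> W) = card U' + card W"
        by (rule card_Un_disjoint) (use fin in \<open>auto simp: U'_def W_def\<close>)
      moreover have "card (U' \<union> W) \<le> card U"
        by (rule card_mono) (use Suc in \<open>auto simp: U'_def W_def\<close>)
      ultimately show ?thesis by simp
    qed
    ultimately show ?thesis using mult_le_mono2 order_trans by blast
  next
    case False
    have "A = {}"
    proof (cases "k = 0")
      case True
      then show ?thesis unfolding A_def clique_chain_def by simp
    next
      case False
      then have "card U' < 2" using \<open>\<not> (0 < k \<and> 2 \<le> card U')\<close> by auto
      moreover have "2 \<le> card U'" if "e \<in> A" for e
        using that card_mono[OF fin(1), of e] clique_chain_card_edge[of e r k] unfolding A_eq by simp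
      ultimately show ?thesis by (meson all_not_in_conv not_less)
    qed
    then have eq: "2 * card {e\<in>clique_chain r (Suc k). e \<subseteq> U} = card (U \<inter> {s..<s + r}) * (card (U \<inter> {s..<s + r}) - 1)"
      unfolding split by (simp add: card_nsets double_choose_two)
    define h where "h = card (U \<inter> {s..<s + r})"
    have hr: "h \<le> r" unfolding h_def using card_mono[of "{s..<s + r}" "U \<inter> {s..<s + r}"] by auto
    have hu: "h \<le> card U" unfolding h_def using Suc by (intro card_mono) auto
    show ?thesis
    proof (cases "h < 2")
      case True
      then have z: "h * (h - 1) = 0" by (cases h) auto
      have "(r + 1) * 2 \<le> (r + 1) * card U" using Suc by (intro mult_left_mono) auto
      then show ?thesis unfolding eq h_def[symmetric] z by simp
    next
      case False
      then obtain h' where h': "h = h' + 2" by (metis add.commute le_Suc_ex not_less)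
      obtain u' where u': "card U = u' + 2" using Suc.prems by (metis add.commute le_Suc_ex)
      \<comment> \<open>What the claim becomes after cancelling \<open>2 * r + 2\<close> on both
        sides.\<close>
      have "h' * (h' + 3) \<le> u' * (r + 1)" using hr hu h' u' by (intro mult_mono) auto
      then show ?thesis using eq unfolding h_def[symmetric] u' h' by (simp add: algebra_simps)
    qed
  qed
qed

text \<open>The density bound is summed over the components. A component cannot skip a block of
  \<open>r\<close> consecutive vertices, because edges are shorter than \<open>r\<close>: an edge
  crossing the cut below a block \<open>i'\<close> starts in block \<open>i' - 1\<close>, which
  therefore is also occupied. Hence distinct runs of blocks meet distinct components.\<close>

lemma clique_chain_components:
  assumes r: "3 \<le> r" and T: "T \<subseteq> clique_chain r k"
  obtains c where "grown T (\<Union>T) c" "2 * card T + 2 * r * c \<le> (r + 1) * card (\<Union>T)"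
    "runs ((\<lambda>u. u div r) ` \<Union>T) \<le> c"
proof -
  have finT: "finite T" using T finite_clique_chain finite_subset by blast
  have "\<And>e. e \<in> T \<Longrightarrow> card e = 2" using T clique_chain_card_edge by blast
  then obtain P where P: "finite P" "disjoint P" "\<Union>P = \<Union>T" "\<forall>e\<in>T. \<exists>U\<in>P. e \<subseteq> U"
      "\<forall>U\<in>P. cut_connected T U \<and> finite U \<and> 2 \<le> card U"
    using connected_partition_exists[OF finT] by metis
  have "grown T (\<Union>P) (card P)"
    by (rule grown_Union_partition) (use P in auto)
  then have 1: "grown T (\<Union>T) (card P)" using P by simp
  have "T \<subseteq> (\<Union>U\<in>P. {e\<in>clique_chain r k. e \<subseteq> U})" using P(4) T by auto
  then have "card T \<le> card (\<Union>U\<in>P. {e\<in>clique_chain r k. e \<subseteq> U})"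
    by (rule card_mono[rotated]) (use P(1) finite_clique_chain in auto)
  also have "\<dots> \<le> (\<Sum>U\<in>P. card {e\<in>clique_chain r k. e \<subseteq> U})" by (rule card_UN_le[OF P(1)])
  finally have "2 * card T + 2 * r * card P \<le> (\<Sum>U\<in>P. 2 * card {e\<in>clique_chain r k. e \<subseteq> U} + 2 * r)"
    by (simp add: sum.distrib sum_distrib_left[symmetric] mult_ac)
  also have "\<dots> \<le> (\<Sum>U\<in>P. (r + 1) * card U)"
    by (intro sum_mono clique_chain_density r) (use P(5) in auto)
  also have "\<dots> = (r + 1) * card (\<Union>P)"
    using P(2,5) by (subst card_Union_disjoint) (auto simp: sum_distrib_left)
  finally have 2: "2 * card T + 2 * r * card P \<le> (r + 1) * card (\<Union>T)" using P by simp
  define B where "B = (\<lambda>u. u div r) ` \<Union>T"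
  have "\<forall>i\<in>B. \<exists>U. U \<in> P \<and> (\<exists>u\<in>U. u div r = i)"
    unfolding B_def using P(3) by blast
  from bchoice[OF this] obtain f where "\<forall>i\<in>B. f i \<in> P \<and> (\<exists>u\<in>f i. u div r = i)" ..
  then have f: "f i \<in> P \<and> (\<exists>u\<in>f i. u div r = i)" if "i \<in> {i\<in>B. \<forall>j\<in>B. Suc j \<noteq> i}" for i
    using that by blast
  have neq: "f i \<noteq> f i'" if i: "i \<in> {i\<in>B. \<forall>j\<in>B. Suc j \<noteq> i}" and i': "i' \<in> {i\<in>B. \<forall>j\<in>B. Suc j \<noteq> i}"
    and less: "i < i'" for i i'
  proof
    assume eq: "f i = f i'"
    define X where "X = {u\<in>f i. u div r < i'}"
    have "X \<subseteq> f i" "X \<noteq> {}" "X \<noteq> f i" unfolding X_def using f[OF i] f[OF i'] eq less by auto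
    moreover have "cut_connected T (f i)" using f[OF i] P(5) by auto
    ultimately obtain a b where ab: "a \<in> X" "b \<in> f i - X" "{a, b} \<in> T"
      unfolding cut_connected_def by meson
    have "b < a + r" using ab T clique_chain_edge_less by blast
    then have "b div r \<le> (a + r) div r" by (intro div_le_mono) auto
    then have "b div r \<le> Suc (a div r)" using r by simp
    then have "Suc (a div r) = i'" using ab unfolding X_def by auto
    moreover have "a div r \<in> B" unfolding B_def using ab(3) by auto
    ultimately show False using i' by auto
  qed
  have "inj_on f {i\<in>B. \<forall>j\<in>B. Suc j \<noteq> i}"
    by (rule linorder_inj_onI) (use neq in auto)
  then have "runs B \<le> card P"
    unfolding runs_def using f P(1) by (intro card_inj_on_le[of f]) auto
  then show ?thesis using that[OF 1 2] unfolding B_def by auto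
qed

subsection \<open>Counting edge sets by runs of blocks\<close>

lemma runs_insert_above:
  assumes "finite B" "\<And>a. a \<in> B \<Longrightarrow> a < b"
  shows "runs (insert b B) = runs B + (if \<exists>j\<in>B. Suc j = b then 0 else 1)"
proof -
  have "b \<notin> B" using assms by auto
  have eq: "{i\<in>insert b B. \<forall>j\<in>insert b B. Suc j \<noteq> i}
      = {i\<in>B. \<forall>j\<in>B. Suc j \<noteq> i} \<union> (if \<exists>j\<in>B. Suc j = b then {} else {b})"
    using assms(2) by (auto split: if_splits) (metis Suc_lessD less_irrefl)+
  show ?thesis
    unfolding runs_def eq using \<open>b \<notin> B\<close> assms(1) by (auto simp: card_insert_if)
qed

text \<open>Doubling the weight of the sets that contain the current maximum makes the induction go
  through: it pays for extending the last run, which costs \<open>x\<close> instead of \<open>x * y\<close>.\<close>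

lemma sum_power_runs_weighted_le:
  fixes x y :: real
  assumes "finite D" and x: "0 \<le> x" "x \<le> 1 / 2" and y: "0 \<le> y"
  shows "(\<Sum>B\<in>Pow D. x ^ card B * y ^ runs B * (if D \<noteq> {} \<and> Max D \<in> B then 2 else 1))
           \<le> (1 + 2 * x * y) ^ card D"
  using assms(1)
proof (induction D rule: finite_linorder_max_induct)
  case empty
  then show ?case by (simp add: runs_def)
next
  case (insert b D)
  define w where "w B = x ^ card B * y ^ runs B" for B
  have w: "0 \<le> w B" for B unfolding w_def using x y by simp
  have bD: "b \<notin> D" using insert by auto
  have Mx: "Max (insert b D) = b" using insert by (intro Max_eqI) auto
  have inj: "inj_on (insert b) (Pow D)"
    using bD by (intro inj_onI) (metis Diff_insert_absorb PowD in_mono)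
  have "(\<Sum>B\<in>Pow (insert b D). w B * (if insert b D \<noteq> {} \<and> Max (insert b D) \<in> B then 2 else 1))
      = (\<Sum>B\<in>Pow D. w B * (if b \<in> B then 2 else 1))
        + (\<Sum>B\<in>insert b ` Pow D. w B * (if b \<in> B then 2 else 1))"
    unfolding Mx Pow_insert by (simp, rule sum.union_disjoint) (use bD insert.hyps in auto)
  also have "\<dots> = (\<Sum>B\<in>Pow D. w B * (if b \<in> B then 2 else 1)) + (\<Sum>B\<in>Pow D. 2 * w (insert b B))"
    by (subst sum.reindex[OF inj]) (simp add: mult.commute)
  also have "\<dots> = (\<Sum>B\<in>Pow D. w B + 2 * w (insert b B))"
    unfolding sum.distrib by (intro arg_cong2[where f = "(+)"] sum.cong refl) (use bD in auto)
  also have "\<dots> \<le> (\<Sum>B\<in>Pow D. (1 + 2 * x * y) * (w B * (if D \<noteq> {} \<and> Max D \<in> B then 2 else 1)))"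
  proof (rule sum_mono)
    fix B assume "B \<in> Pow D"
    then have BD: "B \<subseteq> D" by auto
    have finB: "finite B" using BD insert.hyps finite_subset by blast
    have lt: "a < b" if "a \<in> B" for a using that BD insert by auto
    have rI: "runs (insert b B) = runs B + (if \<exists>j\<in>B. Suc j = b then 0 else 1)"
      by (rule runs_insert_above) (use finB lt in auto)
    have cB: "card (insert b B) = Suc (card B)" using BD bD finB by (auto simp: card_insert_if)
    show "w B + 2 * w (insert b B) \<le> (1 + 2 * x * y) * (w B * (if D \<noteq> {} \<and> Max D \<in> B then 2 else 1))"
    proof (cases "\<exists>j\<in>B. Suc j = b")
      case True
      \<comment> \<open>Here \<open>B\<close> ends in \<open>Max D\<close> and carries weight 2.
        Adding \<open>b\<close> prolongs the last run, and
        \<open>w B + 2 * x * w B <= 2 * w B\<close> because \<open>x <= 1 / 2\<close>.\<close>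
      then obtain j where j: "j \<in> B" "Suc j = b" by auto
      have "Max D = j"
        by (rule Max_eqI) (use j BD insert in \<open>auto simp: less_Suc_eq_le\<close>)
      then have M: "D \<noteq> {} \<and> Max D \<in> B" using j BD by auto
      have "w (insert b B) = x * w B"
        unfolding w_def rI cB using True by simp
      then have "w B + 2 * w (insert b B) \<le> 2 * w B"
        using mult_right_mono[OF x(2) w[of B]] by simp
      also have "\<dots> \<le> (1 + 2 * x * y) * (w B * 2)"
        using mult_right_mono[of 1 "1 + 2 * x * y" "w B * 2"] w[of B] x y by (simp add: mult_ac)
      finally show ?thesis using M by simp
    next
      case False
      have "w (insert b B) = x * y * w B"
        unfolding w_def rI cB using False by (simp add: mult_ac)
      then have "w B + 2 * w (insert b B) = (1 + 2 * x * y) * w B" by (simp add: algebra_simps)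
      also have "\<dots> \<le> (1 + 2 * x * y) * (w B * (if D \<noteq> {} \<and> Max D \<in> B then 2 else 1))"
        by (intro mult_left_mono) (use w[of B] x y in auto)
      finally show ?thesis .
    qed
  qed
  also have "\<dots> = (1 + 2 * x * y) * (\<Sum>B\<in>Pow D. w B * (if D \<noteq> {} \<and> Max D \<in> B then 2 else 1))"
    by (simp add: sum_distrib_left)
  also have "\<dots> \<le> (1 + 2 * x * y) * (1 + 2 * x * y) ^ card D"
    using insert.IH x y unfolding w_def by (intro mult_left_mono) auto
  finally show ?case unfolding w_def using bD insert.hyps by simp
qed

lemma sum_power_runs_le:
  fixes x y :: real
  assumes "finite D" and x: "0 \<le> x" "x \<le> 1 / 2" and y: "0 \<le> y"
  shows "(\<Sum>B\<in>Pow D. x ^ card B * y ^ runs B) \<le> (1 + 2 * x * y) ^ card D"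
proof -
  have "(\<Sum>B\<in>Pow D. x ^ card B * y ^ runs B)
      \<le> (\<Sum>B\<in>Pow D. x ^ card B * y ^ runs B * (if D \<noteq> {} \<and> Max D \<in> B then 2 else 1))"
  proof (rule sum_mono)
    fix B assume "B \<in> Pow D"
    have "0 \<le> x ^ card B * y ^ runs B" using x y by simp
    then show "x ^ card B * y ^ runs B
        \<le> x ^ card B * y ^ runs B * (if D \<noteq> {} \<and> Max D \<in> B then 2 else 1)" by auto
  qed
  then show ?thesis using sum_power_runs_weighted_le[OF assms] by linarith
qed

text \<open>The block length is the span of a clique, so an edge of the chain lies in one block or
  joins two neighbouring ones.\<close>

definition blocks :: "nat \<Rightarrow> nat set set \<Rightarrow> nat set" where
  "blocks r T = (\<lambda>u. u div r) ` \<Union>T"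

lemma card_Union_edges_le:
  assumes "finite T" "\<And>e. e \<in> T \<Longrightarrow> card e = 2"
  shows "card (\<Union>T) \<le> 2 * card T"
proof -
  have "card (\<Union>T) \<le> sum card T" by (rule card_Union_le_sum_card)
  also have "\<dots> = 2 * card T" using assms(2) by simp
  finally show ?thesis .
qed

lemma card_blocks_le:
  assumes "finite T" "\<And>e. e \<in> T \<Longrightarrow> card e = 2"
  shows "card (blocks r T) \<le> 2 * card T"
proof -
  have "finite (\<Union>T)" using assms by (auto intro!: finite_Union simp: card_ge_0_finite)
  then have "card (blocks r T) \<le> card (\<Union>T)" unfolding blocks_def by (rule card_image_le)
  then show ?thesis using card_Union_edges_le[OF assms] by simp
qed

text \<open>The smaller end of an edge lies in one of \<open>r * card B\<close> vertices and its
  length takes at most \<open>r\<close> values, so only \<open>r * r * card B\<close> edges are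
  available.\<close>

lemma card_edge_sets_with_blocks_le:
  assumes r: "0 < r" and B: "finite B"
    and short: "\<And>e. e \<in> L \<Longrightarrow> \<exists>a j. e = {a, a + j} \<and> j < r"
  shows "card {T\<in>Pow L. blocks r T = B} \<le> 2 ^ (r * r * card B)"
proof -
  define V where "V = (\<Union>i\<in>B. {i * r..<i * r + r})"
  define K where "K = (\<lambda>(a, j). {a, a + j}) ` (V \<times> {..<r})"
  have finV: "finite V" unfolding V_def using B by auto
  have finK: "finite K" unfolding K_def using finV by auto
  have "card V \<le> (\<Sum>i\<in>B. card {i * r..<i * r + r})" unfolding V_def by (rule card_UN_le[OF B])
  then have cV: "card V \<le> r * card B" by (simp add: mult.commute)
  have "card K \<le> card (V \<times> {..<r})" unfolding K_def by (rule card_image_le) (use finV in auto)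
  also have "\<dots> = card V * r" by (simp add: card_cartesian_product)
  also have "\<dots> \<le> r * r * card B" using mult_right_mono[OF cV, of r] by (simp add: mult_ac)
  finally have cK: "card K \<le> r * r * card B" .
  have "{T\<in>Pow L. blocks r T = B} \<subseteq> Pow K"
  proof clarify
    fix T e assume T: "T \<subseteq> L" "B = blocks r T" and e: "e \<in> T"
    obtain a j where aj: "e = {a, a + j}" "j < r" using short e T by blast
    have "a div r \<in> B" unfolding T(2) blocks_def using e aj by auto
    moreover have "a \<in> {a div r * r..<a div r * r + r}"
      using dividend_less_div_times[OF r, of a] by (simp add: add.commute)
    ultimately have "a \<in> V" unfolding V_def by blast
    then show "e \<in> K" unfolding K_def using aj by auto
  qed
  then have "card {T\<in>Pow L. blocks r T = B} \<le> card (Pow K)" using finK by (intro card_mono) auto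
  also have "\<dots> = 2 ^ card K" using finK by (rule card_Pow)
  also have "\<dots> \<le> 2 ^ (r * r * card B)" using cK by (intro power_increasing) auto
  finally show ?thesis .
qed

text \<open>An edge touches at most two blocks, so a weight \<open>s^2\<close> per edge is at most a
  weight \<open>s\<close> per block; this is why the weight is a square. The number of edge sets
  with the same blocks is absorbed by replacing \<open>s\<close> with
  \<open>2 ^ (r * r) * s\<close>.\<close>

lemma sum_edge_sets_le:
  fixes s y :: real
  assumes r: "0 < r" and L: "finite L" "\<And>e. e \<in> L \<Longrightarrow> card e = 2"
      "\<And>e. e \<in> L \<Longrightarrow> \<exists>a j. e = {a, a + j} \<and> j < r"
    and s: "0 \<le> s" "2 ^ (r * r) * s \<le> 1 / 2" and y: "0 \<le> y"
  shows "(\<Sum>T\<in>Pow L. (s\<^sup>2) ^ card T * y ^ runs (blocks r T))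
           \<le> (1 + 2 * (2 ^ (r * r) * s) * y) ^ card (blocks r L)"
proof -
  have "(1::real) \<le> 2 ^ (r * r)" by simp
  then have s1: "s \<le> 1" using s mult_right_mono[of 1 "2 ^ (r * r)" s] by simp
  have finbL: "finite (blocks r L)"
    unfolding blocks_def using L by (auto intro!: finite_Union simp: card_ge_0_finite)
  have sub: "blocks r ` Pow L \<subseteq> Pow (blocks r L)" unfolding blocks_def by auto
  have "(\<Sum>T\<in>Pow L. (s\<^sup>2) ^ card T * y ^ runs (blocks r T))
      = (\<Sum>B\<in>Pow (blocks r L). \<Sum>T\<in>{T\<in>Pow L. blocks r T = B}. (s\<^sup>2) ^ card T * y ^ runs (blocks r T))"
    by (rule sum.group[symmetric]) (use L finbL sub in auto)
  also have "\<dots> \<le> (\<Sum>B\<in>Pow (blocks r L). (2 ^ (r * r) * s) ^ card B * y ^ runs B)"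
  proof (rule sum_mono)
    fix B assume "B \<in> Pow (blocks r L)"
    then have finB: "finite B" using finbL finite_subset by auto
    have "(\<Sum>T\<in>{T\<in>Pow L. blocks r T = B}. (s\<^sup>2) ^ card T * y ^ runs (blocks r T))
        \<le> (\<Sum>T\<in>{T\<in>Pow L. blocks r T = B}. s ^ card B * y ^ runs B)"
    proof (rule sum_mono, clarsimp, rule mult_right_mono)
      fix T assume T: "T \<subseteq> L"
      have "card (blocks r T) \<le> 2 * card T"
        by (rule card_blocks_le) (use T L finite_subset in auto)
      then have "s ^ (2 * card T) \<le> s ^ card (blocks r T)"
        using s s1 by (intro power_decreasing) auto
      then show "(s\<^sup>2) ^ card T \<le> s ^ card (blocks r T)" by (simp add: power_mult)
    qed (use y in auto)
    also have "\<dots> = real (card {T\<in>Pow L. blocks r T = B}) * (s ^ card B * y ^ runs B)" by simp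
    also have "\<dots> \<le> 2 ^ (r * r * card B) * (s ^ card B * y ^ runs B)"
    proof (rule mult_right_mono)
      have "card {T\<in>Pow L. blocks r T = B} \<le> 2 ^ (r * r * card B)"
        by (rule card_edge_sets_with_blocks_le[OF r finB L(3)])
      then show "real (card {T\<in>Pow L. blocks r T = B}) \<le> 2 ^ (r * r * card B)"
        by (metis of_nat_le_iff of_nat_numeral of_nat_power)
    qed (use s y in auto)
    also have "\<dots> = (2 ^ (r * r) * s) ^ card B * y ^ runs B"
      by (simp add: power_mult power_mult_distrib mult_ac)
    finally show "(\<Sum>T\<in>{T\<in>Pow L. blocks r T = B}. (s\<^sup>2) ^ card T * y ^ runs (blocks r T))
        \<le> (2 ^ (r * r) * s) ^ card B * y ^ runs B" .
  qed
  also have "\<dots> \<le> (1 + 2 * (2 ^ (r * r) * s) * y) ^ card (blocks r L)"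
    by (rule sum_power_runs_le) (use finbL s y in auto)
  finally show ?thesis .
qed

subsection \<open>Copies containing a given edge set\<close>

definition copy_of :: "'a set set \<Rightarrow> ('a \<Rightarrow> 'a) \<Rightarrow> 'a set set" where
  "copy_of G \<pi> = (\<lambda>e. \<pi> ` e) ` G"

text \<open>Divided by \<open>fact n\<close>, this is the probability that a uniformly random copy
  contains \<open>T\<close>. Indexing by permutations counts every copy equally often, so
  automorphisms need no separate treatment.\<close>

definition copies_above :: "nat \<Rightarrow> nat set set \<Rightarrow> nat set set \<Rightarrow> nat" where
  "copies_above n G T = card {\<pi>\<in>{\<pi>. \<pi> permutes {..<n}}. T \<subseteq> copy_of G \<pi>}"

lemma inj_image_permutes: "\<pi> permutes S \<Longrightarrow> inj (\<lambda>e. \<pi> ` e)"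
  by (metis inj_def inj_image_eq_iff permutes_inj)

lemma copy_of_comp: "copy_of G (\<tau> \<circ> \<pi>) = copy_of (copy_of G \<pi>) \<tau>"
  by (simp add: copy_of_def image_image image_comp)

lemma copy_of_mono: "S \<subseteq> T \<Longrightarrow> copy_of S \<pi> \<subseteq> copy_of T \<pi>"
  unfolding copy_of_def by blast

lemma copy_of_inv: "\<pi> permutes S \<Longrightarrow> copy_of (copy_of G \<pi>) (inv \<pi>) = G"
  by (simp add: copy_of_comp[symmetric] permutes_inv_o) (simp add: copy_of_def)

lemma copy_of_inv': "\<pi> permutes S \<Longrightarrow> copy_of (copy_of G (inv \<pi>)) \<pi> = G"
  by (simp add: copy_of_comp[symmetric] permutes_inv_o) (simp add: copy_of_def)

lemma card_copy_of: "\<pi> permutes S \<Longrightarrow> card (copy_of G \<pi>) = card G"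
  unfolding copy_of_def by (rule card_image) (meson inj_image_permutes inj_on_subset subset_UNIV)

lemma contains_copy_iff_permutation:
  assumes "\<And>e. e \<in> G \<Longrightarrow> e \<subseteq> {..<n::nat}"
  shows "contains_copy ({..<n}, G) ({..<n}, W) \<longleftrightarrow> (\<exists>\<pi>\<in>{\<pi>. \<pi> permutes {..<n}}. copy_of G \<pi> \<subseteq> W)"
proof
  assume "contains_copy ({..<n}, G) ({..<n}, W)"
  then obtain f where f: "inj_on f {..<n}" "f ` {..<n} \<subseteq> {..<n}" "\<forall>e\<in>G. f ` e \<in> W"
    unfolding contains_copy_def by auto
  \<comment> \<open>An injection of a finite set into itself is a bijection; extending it by the
    identity turns it into a permutation.\<close>
  define \<pi> where "\<pi> x = (if x < n then f x else x)" for x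
  have "f ` {..<n} = {..<n}" using f by (intro endo_inj_surj) auto
  then have "bij_betw f {..<n} {..<n}" using f by (simp add: bij_betw_def)
  then have "bij_betw \<pi> {..<n} {..<n}"
    by (rule bij_betw_cong[THEN iffD1, rotated]) (auto simp: \<pi>_def)
  then have "\<pi> permutes {..<n}" by (rule bij_imp_permutes) (auto simp: \<pi>_def)
  moreover have "copy_of G \<pi> \<subseteq> W"
  proof -
    have "\<pi> ` e = f ` e" if "e \<in> G" for e
      using assms[OF that] by (intro image_cong) (auto simp: \<pi>_def)
    then show ?thesis using f(3) unfolding copy_of_def by auto
  qed
  ultimately show "\<exists>\<pi>\<in>{\<pi>. \<pi> permutes {..<n}}. copy_of G \<pi> \<subseteq> W" by blast
next
  assume "\<exists>\<pi>\<in>{\<pi>. \<pi> permutes {..<n}}. copy_of G \<pi> \<subseteq> W"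
  then obtain \<pi> where \<pi>: "\<pi> permutes {..<n}" "copy_of G \<pi> \<subseteq> W" by auto
  show "contains_copy ({..<n}, G) ({..<n}, W)"
    unfolding contains_copy_def
    by (rule exI[of _ \<pi>])
       (use \<pi> permutes_inj_on[OF \<pi>(1)] permutes_image[OF \<pi>(1)] in \<open>auto simp: copy_of_def\<close>)
qed

lemma finite_permutations_lessThan: "finite {\<pi>. \<pi> permutes {..<n::nat}}"
  by (rule finite_permutations) simp

lemma copies_above_antimono: "S \<subseteq> T \<Longrightarrow> copies_above n G T \<le> copies_above n G S"
  unfolding copies_above_def by (intro card_mono) (auto simp: finite_permutations_lessThan)

text \<open>Random copies are invariant under relabelling: compose with
  \<open>inv \<tau>\<close>.\<close>

lemma copies_above_image_le:
  assumes \<tau>: "\<tau> permutes {..<n}"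
  shows "copies_above n G (copy_of T \<tau>) \<le> copies_above n G T"
  unfolding copies_above_def
proof (rule card_inj_on_le[of "\<lambda>\<pi>. inv \<tau> \<circ> \<pi>"])
  show "inj_on (\<lambda>\<pi>. inv \<tau> \<circ> \<pi>) {\<pi>\<in>{\<pi>. \<pi> permutes {..<n}}. copy_of T \<tau> \<subseteq> copy_of G \<pi>}"
  proof (rule inj_onI)
    fix \<pi> \<pi>' assume "inv \<tau> \<circ> \<pi> = inv \<tau> \<circ> \<pi>'"
    then have "\<tau> \<circ> inv \<tau> \<circ> \<pi> = \<tau> \<circ> inv \<tau> \<circ> \<pi>'" by (simp add: comp_assoc)
    then show "\<pi> = \<pi>'" using permutes_inv_o(1)[OF \<tau>] by simp
  qed
  show "(\<lambda>\<pi>. inv \<tau> \<circ> \<pi>) ` {\<pi>\<in>{\<pi>. \<pi> permutes {..<n}}. copy_of T \<tau> \<subseteq> copy_of G \<pi>}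
      \<subseteq> {\<pi>\<in>{\<pi>. \<pi> permutes {..<n}}. T \<subseteq> copy_of G \<pi>}"
  proof (rule image_subsetI)
    fix \<pi> assume "\<pi> \<in> {\<pi>\<in>{\<pi>. \<pi> permutes {..<n}}. copy_of T \<tau> \<subseteq> copy_of G \<pi>}"
    then have \<pi>: "\<pi> permutes {..<n}" and sub: "copy_of T \<tau> \<subseteq> copy_of G \<pi>" by auto
    have "copy_of (copy_of T \<tau>) (inv \<tau>) \<subseteq> copy_of (copy_of G \<pi>) (inv \<tau>)" by (rule copy_of_mono[OF sub])
    then have "T \<subseteq> copy_of G (inv \<tau> \<circ> \<pi>)" by (simp add: copy_of_inv[OF \<tau>] copy_of_comp)
    moreover have "inv \<tau> \<circ> \<pi> permutes {..<n}" using \<pi> \<tau> by (intro permutes_compose permutes_inv)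
    ultimately show "inv \<tau> \<circ> \<pi> \<in> {\<pi>\<in>{\<pi>. \<pi> permutes {..<n}}. T \<subseteq> copy_of G \<pi>}" by simp
  qed
  show "finite {\<pi>\<in>{\<pi>. \<pi> permutes {..<n}}. T \<subseteq> copy_of G \<pi>}"
    by (simp add: finite_permutations_lessThan)
qed

text \<open>Relative to one member \<open>\<pi>0\<close> of the set, every member yields a
  permutation \<open>\<pi>0 \<circ> inv \<pi>\<close> that is the identity on
  \<open>V\<close>.\<close>

lemma card_permutations_fixing_le:
  assumes V: "V \<subseteq> {..<n::nat}"
  shows "card {\<pi>. \<pi> permutes {..<n} \<and> restrict (inv \<pi>) V = \<phi>} \<le> fact (n - card V)"
proof (cases "{\<pi>. \<pi> permutes {..<n} \<and> restrict (inv \<pi>) V = \<phi>} = {}")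
  case True
  show ?thesis unfolding True by simp
next
  case False
  then obtain \<pi>0 where \<pi>0: "\<pi>0 permutes {..<n}" "restrict (inv \<pi>0) V = \<phi>" by auto
  have "card {\<pi>. \<pi> permutes {..<n} \<and> restrict (inv \<pi>) V = \<phi>} \<le> card {q. q permutes ({..<n} - V)}"
  proof (rule card_inj_on_le[of "\<lambda>\<pi>. \<pi>0 \<circ> inv \<pi>"])
    show "inj_on (\<lambda>\<pi>. \<pi>0 \<circ> inv \<pi>) {\<pi>. \<pi> permutes {..<n} \<and> restrict (inv \<pi>) V = \<phi>}"
    proof (rule inj_onI, clarify)
      fix \<pi> \<pi>' assume *: "\<pi> permutes {..<n}" "\<pi>' permutes {..<n}" "\<pi>0 \<circ> inv \<pi> = \<pi>0 \<circ> inv \<pi>'"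
      have "inv \<pi> x = inv \<pi>' x" for x
        using fun_cong[OF *(3), of x] permutes_inj[OF \<pi>0(1)] by (simp add: inj_eq)
      then have "inv \<pi> = inv \<pi>'" by (rule ext)
      then show "\<pi> = \<pi>'" using *(1,2) by (metis permutes_inv_inv)
    qed
    show "(\<lambda>\<pi>. \<pi>0 \<circ> inv \<pi>) ` {\<pi>. \<pi> permutes {..<n} \<and> restrict (inv \<pi>) V = \<phi>} \<subseteq> {q. q permutes ({..<n} - V)}"
    proof clarify
      fix \<pi> assume \<pi>: "\<pi> permutes {..<n}" "\<phi> = restrict (inv \<pi>) V"
      have per: "\<pi>0 \<circ> inv \<pi> permutes {..<n}" using \<pi> \<pi>0 by (intro permutes_compose permutes_inv)
      have "(\<pi>0 \<circ> inv \<pi>) x = x" if "x \<in> V" for x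
      proof -
        have "inv \<pi> x = inv \<pi>0 x" using \<pi>(2) \<pi>0(2) that by (metis restrict_apply')
        then show ?thesis using permutes_inverses(1)[OF \<pi>0(1)] by simp
      qed
      then show "\<pi>0 \<circ> inv \<pi> permutes ({..<n} - V)"
        using per by (intro permutes_superset[OF per]) auto
    qed
  qed (auto intro: finite_permutations)
  also have "\<dots> = fact (n - card V)"
    using V by (intro card_permutations) (auto simp: card_Diff_subset finite_subset)
  finally show ?thesis .
qed

text \<open>If the copy contains \<open>T\<close>, then \<open>inv \<pi>\<close> maps
  \<open>T\<close> homomorphically into \<open>G\<close>. The homomorphisms are counted along the
  \<open>grown\<close> order, and each is extended by at most \<open>fact (n - card V)\<close>
  permutations.\<close>

lemma copies_above_le:
  assumes T: "\<Union>T \<subseteq> {..<n}" and grown: "grown T (\<Union>T) k"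
    and deg: "\<And>x. x < n \<Longrightarrow> card {y\<in>{..<n}. {x, y} \<in> G} \<le> d"
  shows "copies_above n G T \<le> n ^ k * d ^ (card (\<Union>T) - k) * fact (n - card (\<Union>T))"
proof -
  define V where "V = \<Union>T"
  define H where "H = {\<phi> \<in> V \<rightarrow>\<^sub>E {..<n}. \<forall>a\<in>V. \<forall>b\<in>V. {a, b} \<in> T \<longrightarrow> {\<phi> a, \<phi> b} \<in> G}"
  have finV: "finite V" unfolding V_def using T finite_subset by blast
  have finH: "finite H"
    unfolding H_def by (rule finite_subset[of _ "V \<rightarrow>\<^sub>E {..<n}"]) (auto intro: finite_PiE finV)
  have cH: "card H \<le> n ^ k * d ^ (card V - k)"
    unfolding H_def V_def using card_homs_le[OF grown, of "{..<n}" G d] deg by auto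
  have "{\<pi>\<in>{\<pi>. \<pi> permutes {..<n}}. T \<subseteq> copy_of G \<pi>}
      \<subseteq> (\<Union>\<phi>\<in>H. {\<pi>. \<pi> permutes {..<n} \<and> restrict (inv \<pi>) V = \<phi>})"
  proof clarify
    fix \<pi> assume \<pi>: "\<pi> permutes {..<n}" and sub: "T \<subseteq> copy_of G \<pi>"
    have TG: "copy_of T (inv \<pi>) \<subseteq> G" using copy_of_mono[OF sub, of "inv \<pi>"] by (simp add: copy_of_inv[OF \<pi>])
    have "restrict (inv \<pi>) V \<in> H"
    proof -
      have "inv \<pi> a \<in> {..<n}" if "a \<in> V" for a
        using permutes_in_image[OF permutes_inv[OF \<pi>], of a] that T unfolding V_def by blast
      moreover have "{inv \<pi> a, inv \<pi> b} \<in> G" if "{a, b} \<in> T" for a b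
      proof -
        have "inv \<pi> ` {a, b} \<in> copy_of T (inv \<pi>)" unfolding copy_of_def using that by (rule imageI)
        then show ?thesis using TG by auto
      qed
      ultimately show ?thesis unfolding H_def by auto
    qed
    then show "\<pi> \<in> (\<Union>\<phi>\<in>H. {\<pi>. \<pi> permutes {..<n} \<and> restrict (inv \<pi>) V = \<phi>})" using \<pi> by blast
  qed
  then have "copies_above n G T \<le> card (\<Union>\<phi>\<in>H. {\<pi>. \<pi> permutes {..<n} \<and> restrict (inv \<pi>) V = \<phi>})"
    unfolding copies_above_def
    by (rule card_mono[rotated]) (use finH in \<open>auto simp: finite_permutations_lessThan\<close>)
  also have "\<dots> \<le> (\<Sum>\<phi>\<in>H. card {\<pi>. \<pi> permutes {..<n} \<and> restrict (inv \<pi>) V = \<phi>})"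
    by (rule card_UN_le[OF finH])
  also have "\<dots> \<le> (\<Sum>\<phi>\<in>H. fact (n - card V))"
    by (intro sum_mono card_permutations_fixing_le) (use T in \<open>auto simp: V_def\<close>)
  also have "\<dots> = card H * fact (n - card V)" by simp
  also have "\<dots> \<le> n ^ k * d ^ (card V - k) * fact (n - card V)" using cH by (intro mult_right_mono) auto
  finally show ?thesis unfolding V_def .
qed

text \<open>A single term of the series for \<open>exp v\<close>.\<close>

lemma power_self_le_exp_fact: "real v ^ v \<le> exp 1 ^ v * fact v"
proof -
  have "real v ^ v /\<^sub>R fact v \<le> (\<Sum>k. real v ^ k /\<^sub>R fact k)"
    using sum_le_suminf[OF summable_exp_generic[of "real v"], of "{v}"] by simp
  also have "\<dots> = exp (real v)" by (simp add: exp_def)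
  also have "\<dots> = exp 1 ^ v" by (simp flip: exp_of_nat_mult)
  finally show ?thesis by (simp add: field_simps)
qed

text \<open>Valid up to \<open>v = n\<close>, where falling factorials are far from powers. The loss
  \<open>exp 1 ^ v\<close> is affordable, since it amounts to a constant factor per edge.\<close>

lemma fact_diff_le:
  assumes "v \<le> n"
  shows "real n ^ v * fact (n - v) \<le> exp 1 ^ v * fact n"
proof (cases "v = 0")
  case False
  have "(real n / real v) ^ v \<le> real (n choose v)" by (rule binomial_ge_n_over_k_pow_k) (use assms in simp)
  then have "real n ^ v \<le> real (n choose v) * real v ^ v"
    using False by (simp add: power_divide field_simps)
  also have "\<dots> \<le> real (n choose v) * (exp 1 ^ v * fact v)"
    by (intro mult_left_mono power_self_le_exp_fact) auto
  finally have "real n ^ v * fact (n - v) \<le> real (n choose v) * (exp 1 ^ v * fact v) * fact (n - v)"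
    by (intro mult_right_mono) auto
  also have "\<dots> = exp 1 ^ v * (fact v * fact (n - v) * real (n choose v))" by (simp add: mult_ac)
  also have "fact v * fact (n - v) * real (n choose v) = fact n"
    using binomial_fact_lemma[OF assms] by (metis of_nat_fact of_nat_mult)
  finally show ?thesis .
qed simp

subsection \<open>The cycle of cliques\<close>

abbreviation cycle_edges :: "nat \<Rightarrow> nat \<Rightarrow> nat set set" where
  "cycle_edges r n \<equiv> snd (clique_cycle r 2 n)"

lemma cycle_edges_eq: "cycle_edges r n = (\<Union>i<n div (r - 2). nsets (clique_block r 2 n i) 2)"
  by (simp add: clique_cycle_def)

lemma clique_block_subset: "0 < n \<Longrightarrow> clique_block r s n i \<subseteq> {..<n}"
  unfolding clique_block_def by auto

lemma card_clique_block_le: "card (clique_block r s n i) \<le> r"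
  unfolding clique_block_def using card_image_le[of "{..<r}"] by simp

lemma finite_clique_block: "finite (clique_block r s n i)"
  unfolding clique_block_def by simp

lemma cycle_edges_subset:
  assumes "0 < n"
  shows "cycle_edges r n \<subseteq> nsets {..<n} 2"
  unfolding cycle_edges_eq using nsets_mono[OF clique_block_subset[OF assms]] by blast

lemma finite_cycle_edges: "finite (cycle_edges r n)"
  unfolding cycle_edges_eq by (auto intro: finite_imp_finite_nsets finite_clique_block)

lemma cycle_edges_degree_le:
  assumes x: "x < n"
  shows "card {y\<in>{..<n}. {x, y} \<in> cycle_edges r n} \<le> 2 * r"
proof -
  \<comment> \<open>Neighbours are fewer than \<open>r\<close> steps ahead or behind;
    \<open>(n - 1) * d\<close> represents \<open>- d\<close> modulo \<open>n\<close> in the natural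
    numbers.\<close>
  have "{y\<in>{..<n}. {x, y} \<in> cycle_edges r n}
      \<subseteq> (\<lambda>d. (x + d) mod n) ` {..<r} \<union> (\<lambda>d. (x + (n - 1) * d) mod n) ` {..<r}"
  proof
    fix y assume "y \<in> {y\<in>{..<n}. {x, y} \<in> cycle_edges r n}"
    then have y: "y < n" "{x, y} \<in> cycle_edges r n" by auto
    then obtain i where "x \<in> clique_block r 2 n i" "y \<in> clique_block r 2 n i"
      unfolding cycle_edges_eq by auto
    then obtain j j' where j: "j < r" "j' < r" "x = (i * (r - 2) + j) mod n" "y = (i * (r - 2) + j') mod n"
      unfolding clique_block_def by auto
    show "y \<in> (\<lambda>d. (x + d) mod n) ` {..<r} \<union> (\<lambda>d. (x + (n - 1) * d) mod n) ` {..<r}"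
    proof (cases "j \<le> j'")
      case True
      have "(x + (j' - j)) mod n = (i * (r - 2) + j + (j' - j)) mod n"
        unfolding j(3) by (simp add: mod_add_left_eq)
      also have "\<dots> = y" unfolding j(4) using True by simp
      finally have "y = (x + (j' - j)) mod n" by simp
      then show ?thesis using j by (intro UnI1 image_eqI[of _ _ "j' - j"]) auto
    next
      case False
      have "(y + (j - j')) mod n = (i * (r - 2) + j' + (j - j')) mod n"
        unfolding j(4) by (simp add: mod_add_left_eq)
      also have "\<dots> = x" unfolding j(3) using False by simp
      finally have xe: "x = (y + (j - j')) mod n" by simp
      have "(x + (n - 1) * (j - j')) mod n = (y + (j - j') + (n - 1) * (j - j')) mod n"
        by (subst xe) (simp add: mod_add_left_eq)
      also have "y + (j - j') + (n - 1) * (j - j') = y + n * (j - j')"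
        using x by (cases n) auto
      also have "\<dots> mod n = y" using y by simp
      finally have "y = (x + (n - 1) * (j - j')) mod n" by simp
      then show ?thesis using j by (intro UnI2 image_eqI[of _ _ "j - j'"]) auto
    qed
  qed
  then have "card {y\<in>{..<n}. {x, y} \<in> cycle_edges r n}
      \<le> card ((\<lambda>d. (x + d) mod n) ` {..<r} \<union> (\<lambda>d. (x + (n - 1) * d) mod n) ` {..<r})"
    by (rule card_mono[rotated]) auto
  also have "\<dots> \<le> card ((\<lambda>d. (x + d) mod n) ` {..<r}) + card ((\<lambda>d. (x + (n - 1) * d) mod n) ` {..<r})"
    by (rule card_Un_le)
  also have "\<dots> \<le> card {..<r} + card {..<r}" by (intro add_mono card_image_le) auto
  finally show ?thesis by simp
qed

text \<open>Two cliques have to be left out because of \<open>r = 3\<close>, where the clique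
  starting at \<open>n - 2\<close> already wraps around. For larger \<open>r\<close> only the last
  one does.\<close>

lemma clique_block_linear:
  assumes "3 \<le> r" "n = m * (r - 2)" "i < m - 2"
  shows "clique_block r 2 n i = {i * (r - 2)..<i * (r - 2) + r}"
proof -
  have "(i + 3) * (r - 2) \<le> m * (r - 2)" using assms(3) by (intro mult_right_mono) auto
  then have "i * (r - 2) + r \<le> n" using assms(1,2) by (simp add: algebra_simps)
  then have "clique_block r 2 n i = (\<lambda>j. i * (r - 2) + j) ` {..<r}"
    unfolding clique_block_def by (intro image_cong) auto
  also have "\<dots> = {i * (r - 2)..<i * (r - 2) + r}"
    by (simp add: lessThan_atLeast0 add.commute)
  finally show ?thesis .
qed

lemma clique_chain_subset_cycle:
  assumes "3 \<le> r" "n = m * (r - 2)"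
  shows "clique_chain r (m - 2) \<subseteq> cycle_edges r n"
proof -
  have nm: "n div (r - 2) = m" using assms by simp
  have "nsets {i * (r - 2)..<i * (r - 2) + r} 2 \<subseteq> cycle_edges r n" if i: "i < m - 2" for i
  proof -
    have "i < n div (r - 2)" using nm i by simp
    then show ?thesis unfolding cycle_edges_eq clique_block_linear[OF assms i, symmetric] by blast
  qed
  then show ?thesis unfolding clique_chain_def by blast
qed

definition wrap_vertices :: "nat \<Rightarrow> nat \<Rightarrow> nat \<Rightarrow> nat set" where
  "wrap_vertices r n m = clique_block r 2 n (m - 2) \<union> clique_block r 2 n (m - 1)"

lemma card_wrap_vertices_le: "card (wrap_vertices r n m) \<le> 2 * r"
  unfolding wrap_vertices_def
  using card_Un_le[of "clique_block r 2 n (m - 2)" "clique_block r 2 n (m - 1)"]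
    card_clique_block_le[of r 2 n "m - 2"] card_clique_block_le[of r 2 n "m - 1"] by linarith

lemma cycle_minus_chain:
  assumes "3 \<le> r" "n = m * (r - 2)" "e \<in> cycle_edges r n - clique_chain r (m - 2)"
  shows "e \<in> nsets (clique_block r 2 n (m - 2)) 2 \<union> nsets (clique_block r 2 n (m - 1)) 2"
proof -
  have "n div (r - 2) = m" using assms by simp
  then obtain i where i: "i < m" "e \<in> nsets (clique_block r 2 n i) 2"
    using assms(3) unfolding cycle_edges_eq by auto
  have "\<not> i < m - 2"
    using i(2) assms(3) clique_block_linear[OF assms(1,2)] unfolding clique_chain_def by auto
  then have "i = m - 2 \<or> i = m - 1" using i(1) by linarith
  then show ?thesis using i(2) by auto
qed

lemma card_cycle_minus_chain_le:
  assumes "3 \<le> r" "n = m * (r - 2)"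
  shows "card (cycle_edges r n - clique_chain r (m - 2)) \<le> r * r"
proof -
  have c: "2 * card (nsets (clique_block r 2 n i) 2) \<le> r * r" for i
  proof -
    have "2 * card (nsets (clique_block r 2 n i) 2) = card (clique_block r 2 n i) * (card (clique_block r 2 n i) - 1)"
      by (simp only: card_nsets double_choose_two)
    also have "\<dots> \<le> r * r" using card_clique_block_le[of r 2 n i] by (intro mult_mono) auto
    finally show ?thesis .
  qed
  have "card (cycle_edges r n - clique_chain r (m - 2))
      \<le> card (nsets (clique_block r 2 n (m - 2)) 2 \<union> nsets (clique_block r 2 n (m - 1)) 2)"
    by (rule card_mono) (use cycle_minus_chain[OF assms] in
        \<open>auto simp: finite_imp_finite_nsets finite_clique_block\<close>)
  also have "\<dots> \<le> card (nsets (clique_block r 2 n (m - 2)) 2) + card (nsets (clique_block r 2 n (m - 1)) 2)"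
    by (rule card_Un_le)
  finally show ?thesis using c[of "m - 2"] c[of "m - 1"] by linarith
qed

section \<open>Rotations as automorphisms of the cycle\<close>

definition rotation :: "nat \<Rightarrow> nat \<Rightarrow> nat \<Rightarrow> nat" where
  "rotation n d x = (if x < n then (x + d) mod n else x)"

lemma rotation_permutes: "rotation n d permutes {..<n}"
proof (rule bij_imp_permutes)
  have "inj_on (rotation n d) {..<n}"
  proof (rule linorder_inj_onI)
    fix x y assume xy: "x < y" "x \<in> {..<n}" "y \<in> {..<n}"
    show "rotation n d x \<noteq> rotation n d y"
    proof
      assume "rotation n d x = rotation n d y"
      then have "(y + d) mod n = (x + d) mod n" using xy by (simp add: rotation_def)
      then have "n dvd (y + d) - (x + d)" using xy by (simp add: mod_eq_dvd_iff_nat)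
      then have "n \<le> y - x" using xy by (auto intro: dvd_imp_le)
      then show False using xy by auto
    qed
  qed auto
  moreover have "rotation n d ` {..<n} \<subseteq> {..<n}" by (auto simp: rotation_def)
  ultimately show "bij_betw (rotation n d) {..<n} {..<n}"
    unfolding bij_betw_def using endo_inj_surj by blast
qed (simp add: rotation_def)

lemma rotation_cycle_edges:
  assumes "3 \<le> r" "n = m * (r - 2)" "0 < m" "e \<in> cycle_edges r n"
  shows "rotation n (k * (r - 2)) ` e \<in> cycle_edges r n"
proof -
  have nm: "n div (r - 2) = m" and n: "0 < n" using assms by auto
  obtain i where i: "e \<in> nsets (clique_block r 2 n i) 2"
    using assms(4) unfolding cycle_edges_eq by auto
  have "rotation n (k * (r - 2)) ` e \<subseteq> clique_block r 2 n ((i + k) mod m)"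
  proof
    fix z assume "z \<in> rotation n (k * (r - 2)) ` e"
    then obtain j where j: "j < r" "z = rotation n (k * (r - 2)) ((i * (r - 2) + j) mod n)"
      using i unfolding nsets_def clique_block_def by auto
    have "z = (i * (r - 2) + j + k * (r - 2)) mod n"
      using n j by (simp add: rotation_def mod_add_left_eq)
    also have "i * (r - 2) + j + k * (r - 2) = (i + k) * (r - 2) + j" by (simp add: add_mult_distrib)
    \<comment> \<open>Reducing the block index modulo \<open>m\<close> changes the offset by a
      multiple of \<open>m * (r - 2) = n\<close>.\<close>
    also have "(i + k) * (r - 2) = (i + k) mod m * (r - 2) + (i + k) div m * n"
      unfolding assms(2) by (metis add_mult_distrib mod_div_mult_eq mult.assoc)
    also have "(\<dots> + j) mod n = ((i + k) mod m * (r - 2) + j + (i + k) div m * n) mod n"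
      by (simp only: add_ac)
    also have "\<dots> = ((i + k) mod m * (r - 2) + j) mod n" by simp
    finally show "z \<in> clique_block r 2 n ((i + k) mod m)"
      unfolding clique_block_def using j by auto
  qed
  moreover have "card (rotation n (k * (r - 2)) ` e) = 2"
    using i permutes_inj_on[OF rotation_permutes] by (subst card_image) (auto simp: nsets_def)
  ultimately have "rotation n (k * (r - 2)) ` e \<in> nsets (clique_block r 2 n ((i + k) mod m)) 2"
    using i by (auto simp: nsets_def)
  moreover have "(i + k) mod m < m" using assms(3) by simp
  ultimately show ?thesis unfolding cycle_edges_eq nm by blast
qed

text \<open>Pigeonhole over the \<open>m\<close> rotations by multiples of \<open>r - 2\<close>:
  each edge of \<open>T\<close> rules out at most \<open>2 * r\<close> of them, since a given vertex
  reaches each of the at most \<open>2 * r\<close> seam vertices at most once.\<close>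

lemma rotate_into_chain:
  assumes r: "3 \<le> r" and n: "n = m * (r - 2)" and T: "T \<subseteq> cycle_edges r n" and small: "2 * r * card T < m"
  obtains \<rho> where "\<rho> permutes {..<n}" "copy_of T \<rho> \<subseteq> clique_chain r (m - 2)"
proof -
  have m: "0 < m" using small by auto
  have n0: "0 < n" using m n r by simp
  have finT: "finite T" using T finite_cycle_edges finite_subset by blast
  define \<rho> where "\<rho> k = rotation n (k * (r - 2))" for k
  \<comment> \<open>An edge outside the chain has both ends in \<open>wrap_vertices\<close>, so it
    suffices to watch one end, here the smaller.\<close>
  define bad where "bad e = {k\<in>{..<m}. \<rho> k (Min e) \<in> wrap_vertices r n m}" for e
  have e: "e \<noteq> {}" "finite e" "e \<subseteq> {..<n}" if "e \<in> T" for e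
  proof -
    have "e \<in> nsets {..<n} 2" using that T cycle_edges_subset[OF n0] by blast
    then show "e \<noteq> {}" "finite e" "e \<subseteq> {..<n}" by (auto simp: nsets_def)
  qed
  have cbad: "card (bad e) \<le> 2 * r" if eT: "e \<in> T" for e
  proof -
    have x: "Min e < n" using e[OF eT] Min_in by blast
    have neq: "\<rho> k (Min e) \<noteq> \<rho> k' (Min e)" if k: "k < k'" "k' < m" for k k'
    proof
      assume "\<rho> k (Min e) = \<rho> k' (Min e)"
      then have "(Min e + k' * (r - 2)) mod n = (Min e + k * (r - 2)) mod n"
        unfolding \<rho>_def rotation_def using x by simp
      then have "n dvd (Min e + k' * (r - 2)) - (Min e + k * (r - 2))"
        using k by (simp add: mod_eq_dvd_iff_nat)
      then have "n dvd (k' - k) * (r - 2)" by (simp add: diff_mult_distrib)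
      moreover have "0 < (k' - k) * (r - 2)" using k r by simp
      ultimately have "n \<le> (k' - k) * (r - 2)" by (rule dvd_imp_le)
      then have "m \<le> k' - k" unfolding n using r by simp
      then show False using k by simp
    qed
    have "inj_on (\<lambda>k. \<rho> k (Min e)) (bad e)"
      by (rule linorder_inj_onI) (use neq in \<open>auto simp: bad_def\<close>)
    then have "card (bad e) \<le> card (wrap_vertices r n m)"
      by (rule card_inj_on_le) (auto simp: bad_def wrap_vertices_def finite_clique_block)
    then show ?thesis using card_wrap_vertices_le[of r n m] by simp
  qed
  have "card (\<Union>e\<in>T. bad e) \<le> (\<Sum>e\<in>T. card (bad e))" by (rule card_UN_le[OF finT])
  also have "\<dots> \<le> (\<Sum>e\<in>T. 2 * r)" by (intro sum_mono cbad)
  also have "\<dots> < card {..<m}" using small by (simp add: mult_ac)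
  finally obtain k where k: "k < m" "k \<notin> (\<Union>e\<in>T. bad e)"
    using card_mono[of "\<Union>e\<in>T. bad e" "{..<m}"] finT by (force simp: bad_def)
  have "\<rho> k ` e \<in> clique_chain r (m - 2)" if eT: "e \<in> T" for e
  proof (rule ccontr)
    assume no: "\<rho> k ` e \<notin> clique_chain r (m - 2)"
    have "\<rho> k ` e \<in> cycle_edges r n"
      unfolding \<rho>_def by (rule rotation_cycle_edges[OF r n m]) (use T eT in auto)
    then have "\<rho> k ` e \<subseteq> wrap_vertices r n m"
      using cycle_minus_chain[OF r n] no unfolding wrap_vertices_def by (auto simp: nsets_def)
    moreover have "Min e \<in> e" using e[OF eT] by simp
    ultimately have "k \<in> bad e" using k unfolding bad_def by auto
    then show False using k eT by auto
  qed
  then have "copy_of T (\<rho> k) \<subseteq> clique_chain r (m - 2)" unfolding copy_of_def by auto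
  then show ?thesis using that[of "\<rho> k"] rotation_permutes unfolding \<rho>_def by blast
qed

subsection \<open>Two-round estimates\<close>

text \<open>The spread estimate. The constant per vertex is \<open>exp 1 * (2 * r)\<close>, from the
  factorial comparison and the degree bound; it appears squared because an edge set covers at most
  two vertices per edge. Components may be replaced by runs because the gain per component is at
  most 1.\<close>

lemma copies_above_chain_le:
  assumes r: "3 \<le> r" and n: "n = m * (r - 2)" "0 < n" and T: "T \<subseteq> clique_chain r (m - 2)"
  shows "real (copies_above n (cycle_edges r n) T)
    \<le> fact n * ((exp 1 * (2 * real r))\<^sup>2 * real n powr (- 2 / (real r + 1))) ^ card T
        * (real n powr (- (real r - 1) / (real r + 1))) ^ runs (blocks r T)"
proof -
  define v where "v = card (\<Union>T)"
  define t where "t = card T"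
  define y where "y = real n powr (- (real r - 1) / (real r + 1))"
  obtain c where c: "grown T (\<Union>T) c" "2 * card T + 2 * r * c \<le> (r + 1) * card (\<Union>T)"
      "runs ((\<lambda>u. u div r) ` \<Union>T) \<le> c"
    using clique_chain_components[OF r T] by blast
  have n1: "1 \<le> real n" using n(2) by simp
  have finT: "finite T" using T finite_clique_chain finite_subset by blast
  have TG: "T \<subseteq> nsets {..<n} 2"
    using T clique_chain_subset_cycle[OF r n(1)] cycle_edges_subset[OF n(2)] by blast
  then have UT: "\<Union>T \<subseteq> {..<n}" by (auto simp: nsets_def)
  have vn: "v \<le> n" unfolding v_def using card_mono[OF _ UT] by simp
  have cv: "c \<le> v" unfolding v_def by (rule grown_le_card[OF c(1)])
  have vt: "v \<le> 2 * t"
    unfolding v_def t_def by (rule card_Union_edges_le[OF finT]) (use TG in \<open>auto simp: nsets_def\<close>)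
  have y: "0 \<le> y" "y \<le> 1"
    unfolding y_def using n1 r powr_mono[of "- (real r - 1) / (real r + 1)" 0 "real n"]
    by (auto simp: divide_nonpos_pos)
  have "real (copies_above n (cycle_edges r n) T) \<le> real (n ^ c * (2 * r) ^ (v - c) * fact (n - v))"
    unfolding v_def of_nat_le_iff
    by (rule copies_above_le[OF UT c(1)]) (use cycle_edges_degree_le in auto)
  also have "\<dots> = real n ^ c * (2 * real r) ^ (v - c) * fact (n - v)" by simp
  also have "\<dots> \<le> real n ^ c * (2 * real r) ^ v * fact (n - v)"
    using r by (intro mult_right_mono mult_left_mono power_increasing) auto
  also have "\<dots> \<le> real n ^ c * (2 * real r) ^ v * (exp 1 ^ v * fact n / real n ^ v)"
    using fact_diff_le[OF vn] n(2) by (intro mult_left_mono) (auto simp: field_simps)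
  also have "\<dots> = fact n * (exp 1 * (2 * real r)) ^ v * (real n powr (real c - real v))"
    using n(2) by (simp add: powr_diff powr_realpow power_mult_distrib)
  also have "\<dots> \<le> fact n * (exp 1 * (2 * real r)) ^ (2 * t)
      * (real n powr (real t * (- 2 / (real r + 1)) + real c * (- (real r - 1) / (real r + 1))))"
  proof (intro mult_mono mult_left_mono)
    have "1 \<le> exp 1 * (2 * real r)"
      using r mult_mono[of 1 "exp 1 :: real" 1 "2 * real r"] by simp
    then show "(exp 1 * (2 * real r)) ^ v \<le> (exp 1 * (2 * real r)) ^ (2 * t)"
      using vt by (intro power_increasing) auto
    have "real (2 * t + 2 * r * c) \<le> real ((r + 1) * v)"
      using c(2) unfolding v_def t_def of_nat_le_iff .
    \<comment> \<open>The density inequality solved for \<open>c - v\<close>, the exponent of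
      \<open>n\<close>: each edge contributes \<open>- 2 / (r + 1)\<close> and each component
      \<open>- (r - 1) / (r + 1)\<close>.\<close>
    then have "(real c - real v) * (real r + 1) \<le> - 2 * real t - (real r - 1) * real c"
      by (simp add: algebra_simps)
    then have "real c - real v \<le> (- 2 * real t - (real r - 1) * real c) / (real r + 1)"
      by (subst pos_le_divide_eq) auto
    also have "\<dots> = real t * (- 2 / (real r + 1)) + real c * (- (real r - 1) / (real r + 1))"
      by (simp add: diff_divide_distrib right_diff_distrib left_diff_distrib mult.commute)
    finally have "real c - real v
        \<le> real t * (- 2 / (real r + 1)) + real c * (- (real r - 1) / (real r + 1))" .
    then show "real n powr (real c - real v)
        \<le> real n powr (real t * (- 2 / (real r + 1)) + real c * (- (real r - 1) / (real r + 1)))"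
      using n1 by (rule powr_mono)
  qed auto
  also have "real n powr (real t * (- 2 / (real r + 1)) + real c * (- (real r - 1) / (real r + 1)))
      = (real n powr (- 2 / (real r + 1))) ^ t * y ^ c"
    unfolding y_def using n(2) by (simp only: powr_add powr_power)
  also have "fact n * (exp 1 * (2 * real r)) ^ (2 * t) * ((real n powr (- 2 / (real r + 1))) ^ t * y ^ c)
      = fact n * ((exp 1 * (2 * real r))\<^sup>2 * real n powr (- 2 / (real r + 1))) ^ t * y ^ c"
  proof -
    have "K ^ (2 * t) * (z ^ t * w) = (K\<^sup>2 * z) ^ t * w" for K z w :: real
      by (simp add: power_mult power_mult_distrib)
    then show ?thesis by (simp only: mult.assoc)
  qed
  also have "\<dots> \<le> fact n * ((exp 1 * (2 * real r))\<^sup>2 * real n powr (- 2 / (real r + 1))) ^ t * y ^ runs (blocks r T)"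
    using c(3) y unfolding blocks_def by (intro mult_left_mono power_decreasing) auto
  finally show ?thesis unfolding t_def y_def .
qed

text \<open>The parameter \<open>s^2\<close> stands for the inverse of the factor by which
  \<open>p\<close> exceeds the critical density, and it is what remains per edge after dividing by
  \<open>p\<close>.\<close>

lemma weighted_copies_above_chain_le:
  fixes s p :: real
  assumes r: "3 \<le> r" and n: "n = m * (r - 2)" "0 < n" and T: "T \<subseteq> clique_chain r (m - 2)"
    and p: "0 < p" "(exp 1 * (2 * real r))\<^sup>2 * real n powr (- 2 / (real r + 1)) \<le> s\<^sup>2 * p"
  shows "(1 / p) ^ card T * real (copies_above n (cycle_edges r n) T)
    \<le> fact n * ((s\<^sup>2) ^ card T * (real n powr (- (real r - 1) / (real r + 1))) ^ runs (blocks r T))"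
proof -
  define K where "K = (exp 1 * (2 * real r))\<^sup>2 * real n powr (- 2 / (real r + 1))"
  define Y where "Y = (real n powr (- (real r - 1) / (real r + 1))) ^ runs (blocks r T)"
  have "(1 / p) ^ card T * real (copies_above n (cycle_edges r n) T) \<le> (1 / p) ^ card T * (fact n * K ^ card T * Y)"
    unfolding K_def Y_def using p by (intro mult_left_mono copies_above_chain_le[OF r n T]) auto
  also have "\<dots> \<le> (1 / p) ^ card T * (fact n * (s\<^sup>2 * p) ^ card T * Y)"
    using p unfolding K_def by (intro mult_left_mono mult_right_mono power_mono) (auto simp: Y_def)
  also have "\<dots> = fact n * ((s\<^sup>2) ^ card T * Y)"
    using p by (simp add: power_mult_distrib power_divide)
  finally show ?thesis unfolding Y_def .
qed

lemma clique_chain_edge_form: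
  assumes "e \<in> clique_chain r k"
  shows "\<exists>a j. e = {a, a + j} \<and> j < r"
proof -
  obtain a b where ab: "e = {a, b}" "a < b"
    using assms unfolding clique_chain_def by (auto simp: ordered_nsets_2_eq)
  then have "b < a + r" using assms clique_chain_edge_less by blast
  then show ?thesis using ab by (intro exI[of _ a] exI[of _ "b - a"]) auto
qed

lemma sum_chain_subsets_le:
  fixes s y :: real
  assumes r: "3 \<le> r" and L: "L \<subseteq> clique_chain r k"
    and s: "0 \<le> s" "2 ^ (r * r) * s \<le> 1 / 2" and y: "0 \<le> y"
  shows "(\<Sum>T\<in>Pow L. (s\<^sup>2) ^ card T * y ^ runs (blocks r T))
           \<le> exp (2 * (2 ^ (r * r) * s) * (y * real (card (blocks r L))))"
proof -
  have "(\<Sum>T\<in>Pow L. (s\<^sup>2) ^ card T * y ^ runs (blocks r T))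
      \<le> (1 + 2 * (2 ^ (r * r) * s) * y) ^ card (blocks r L)"
  proof (rule sum_edge_sets_le)
    show "finite L" using L finite_clique_chain finite_subset by blast
    show "card e = 2" if "e \<in> L" for e using that L clique_chain_card_edge by blast
    show "\<exists>a j. e = {a, a + j} \<and> j < r" if "e \<in> L" for e using that L clique_chain_edge_form by blast
  qed (use r s y in auto)
  also have "\<dots> \<le> exp (2 * (2 ^ (r * r) * s) * y) ^ card (blocks r L)"
    using s y by (intro power_mono exp_ge_add_one_self) auto
  also have "\<dots> = exp (2 * (2 ^ (r * r) * s) * (y * real (card (blocks r L))))"
    by (simp add: exp_of_nat_mult[symmetric] mult_ac)
  finally show ?thesis .
qed

text \<open>A small fragment can be rotated off the seam, so the chain estimate applies to all its
  subsets without loss. It meets fewer than \<open>2 * t\<close> blocks with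
  \<open>t = n powr (2 / (r + 1))\<close>, which keeps the exponent bounded.\<close>

lemma small_fragment_sum_le:
  fixes s p :: real
  assumes r: "3 \<le> r" and n: "n = m * (r - 2)" "0 < n"
    and p: "0 < p" "(exp 1 * (2 * real r))\<^sup>2 * real n powr (- 2 / (real r + 1)) \<le> s\<^sup>2 * p"
    and s: "0 \<le> s" "2 ^ (r * r) * s \<le> 1 / 2"
    and m: "2 * real r * real n powr (2 / (real r + 1)) < real m"
    and \<pi>: "\<pi> permutes {..<n}" and F: "F \<subseteq> copy_of (cycle_edges r n) \<pi>"
      "real (card F) < real n powr (2 / (real r + 1))"
  shows "(\<Sum>T\<in>Pow F - {{}}. (1 / p) ^ card T * real (copies_above n (cycle_edges r n) T))
           \<le> (exp (4 * (2 ^ (r * r) * s)) - 1) * fact n"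
proof -
  let ?G = "cycle_edges r n"
  define y where "y = real n powr (- (real r - 1) / (real r + 1))"
  define F1 where "F1 = copy_of F (inv \<pi>)"
  have \<pi>i: "inv \<pi> permutes {..<n}" by (rule permutes_inv[OF \<pi>])
  have F1: "F1 \<subseteq> ?G" "card F1 = card F" "F = copy_of F1 \<pi>"
    unfolding F1_def using copy_of_mono[OF F(1), of "inv \<pi>"]
    by (simp_all add: copy_of_inv[OF \<pi>] copy_of_inv'[OF \<pi>] card_copy_of[OF \<pi>i])
  have "real (2 * r * card F1) < real m"
    using m F(2) r by (simp add: F1) (smt (verit) mult_left_mono of_nat_0_le_iff)
  then have "2 * r * card F1 < m" by (simp only: of_nat_less_iff)
  then obtain \<rho> where \<rho>: "\<rho> permutes {..<n}" "copy_of F1 \<rho> \<subseteq> clique_chain r (m - 2)"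
    using rotate_into_chain[OF r n(1) F1(1)] by blast
  define F2 where "F2 = copy_of F1 \<rho>"
  define \<tau> where "\<tau> = \<pi> \<circ> inv \<rho>"
  have \<tau>: "\<tau> permutes {..<n}" unfolding \<tau>_def using \<pi> \<rho> by (intro permutes_compose permutes_inv)
  have F2: "F2 \<subseteq> clique_chain r (m - 2)" "card F2 = card F"
    unfolding F2_def using \<rho> F1 by (simp_all add: card_copy_of[OF \<rho>(1)])
  have F\<tau>: "F = copy_of F2 \<tau>"
    unfolding F2_def \<tau>_def copy_of_comp copy_of_inv[OF \<rho>(1)] by (rule F1(3))
  have finF2: "finite F2" using F2 finite_clique_chain finite_subset by blast
  have sub_chain: "T \<subseteq> clique_chain r (m - 2)" if "T \<in> Pow F2" for T using that F2 by auto
  have inj: "inj (\<lambda>T. copy_of T \<tau>)"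
    unfolding copy_of_def using inj_image_permutes[OF \<tau>] by (meson inj_def inj_image_eq_iff)
  have img: "Pow F - {{}} = (\<lambda>T. copy_of T \<tau>) ` (Pow F2 - {{}})"
  proof -
    have "Pow F = (\<lambda>T. copy_of T \<tau>) ` Pow F2"
      unfolding F\<tau> copy_of_def by (rule image_Pow_surj[symmetric]) simp
    moreover have "copy_of {} \<tau> = {}" by (simp add: copy_of_def)
    ultimately show ?thesis
      using image_set_diff[OF inj, of "Pow F2" "{{}}"] by simp
  qed
  have "(\<Sum>T\<in>Pow F - {{}}. (1 / p) ^ card T * real (copies_above n ?G T))
      = (\<Sum>T\<in>Pow F2 - {{}}. (1 / p) ^ card T * real (copies_above n ?G (copy_of T \<tau>)))"
    unfolding img by (subst sum.reindex) (use inj in \<open>auto simp: card_copy_of[OF \<tau>] inj_on_def\<close>)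
  also have "\<dots> \<le> (\<Sum>T\<in>Pow F2 - {{}}. fact n * ((s\<^sup>2) ^ card T * y ^ runs (blocks r T)))"
  proof (rule sum_mono)
    fix T assume T: "T \<in> Pow F2 - {{}}"
    have "(1 / p) ^ card T * real (copies_above n ?G (copy_of T \<tau>)) \<le> (1 / p) ^ card T * real (copies_above n ?G T)"
      using p by (intro mult_left_mono of_nat_mono copies_above_image_le[OF \<tau>]) auto
    also have "\<dots> \<le> fact n * ((s\<^sup>2) ^ card T * y ^ runs (blocks r T))"
      unfolding y_def by (rule weighted_copies_above_chain_le[OF r n _ p]) (use T sub_chain in auto)
    finally show "(1 / p) ^ card T * real (copies_above n ?G (copy_of T \<tau>))
        \<le> fact n * ((s\<^sup>2) ^ card T * y ^ runs (blocks r T))" .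
  qed
  also have "\<dots> = fact n * (\<Sum>T\<in>Pow F2 - {{}}. (s\<^sup>2) ^ card T * y ^ runs (blocks r T))"
    by (simp add: sum_distrib_left)
  \<comment> \<open>The empty set contributes exactly 1; removing it is what makes the bound tend to
    0 with \<open>s\<close>.\<close>
  also have "(\<Sum>T\<in>Pow F2 - {{}}. (s\<^sup>2) ^ card T * y ^ runs (blocks r T))
      = (\<Sum>T\<in>Pow F2. (s\<^sup>2) ^ card T * y ^ runs (blocks r T)) - 1"
    using finF2 by (subst sum_diff1) (auto simp: blocks_def runs_def)
  also have "fact n * \<dots> \<le> fact n * (exp (4 * (2 ^ (r * r) * s)) - 1)"
  proof (intro mult_left_mono diff_right_mono)
    have "(\<Sum>T\<in>Pow F2. (s\<^sup>2) ^ card T * y ^ runs (blocks r T))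
        \<le> exp (2 * (2 ^ (r * r) * s) * (y * real (card (blocks r F2))))"
      by (rule sum_chain_subsets_le[OF r F2(1) s]) (simp add: y_def)
    also have "\<dots> \<le> exp (2 * (2 ^ (r * r) * s) * 2)"
    proof -
      have "card (blocks r F2) \<le> 2 * card F2"
        by (rule card_blocks_le[OF finF2]) (use F2 clique_chain_card_edge in blast)
      then have "real (card (blocks r F2)) \<le> 2 * real n powr (2 / (real r + 1))"
        using F F2 by linarith
      then have "y * real (card (blocks r F2)) \<le> y * (2 * real n powr (2 / (real r + 1)))"
        by (intro mult_left_mono) (auto simp: y_def)
      also have "\<dots> = 2 * real n powr (- (real r - 1) / (real r + 1) + 2 / (real r + 1))"
        unfolding y_def powr_add by simp
      \<comment> \<open>The exponent is nonpositive because \<open>r >= 3\<close>.\<close>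
      also have "\<dots> = 2 * real n powr ((3 - real r) / (real r + 1))"
        by (simp add: add_divide_distrib[symmetric] diff_divide_distrib[symmetric])
      also have "\<dots> \<le> 2 * real n powr 0"
        using n(2) r by (intro mult_left_mono powr_mono) (auto simp: divide_nonpos_pos)
      finally have "y * real (card (blocks r F2)) \<le> 2" using n(2) by simp
      then show ?thesis unfolding exp_le_cancel_iff by (rule mult_left_mono) (use s in simp)
    qed
    finally show "(\<Sum>T\<in>Pow F2. (s\<^sup>2) ^ card T * y ^ runs (blocks r T)) \<le> exp (4 * (2 ^ (r * r) * s))"
      by (simp add: mult_ac)
  qed auto
  finally show ?thesis by (simp add: mult.commute)
qed

text \<open>The at most \<open>r * r\<close> edges of the cycle outside the chain cost only a factor polynomial in
  \<open>n\<close>, which the factor \<open>2 powr - t\<close> gained from \<open>t \<le> card T\<close> absorbs.\<close>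

lemma large_fragment_sum_le:
  fixes s p :: real
  assumes r: "3 \<le> r" and n: "n = m * (r - 2)" "0 < n"
    and p: "0 < p" "p \<le> 1" "2 * (exp 1 * (2 * real r))\<^sup>2 * real n powr (- 2 / (real r + 1)) \<le> s\<^sup>2 * p"
    and s: "0 \<le> s" "2 ^ (r * r) * s \<le> 1 / 4" and t: "t = real n powr (2 / (real r + 1))"
    and \<pi>: "\<pi> permutes {..<n}"
  shows "(\<Sum>T\<in>{T. T \<subseteq> copy_of (cycle_edges r n) \<pi> \<and> t \<le> real (card T)}.
            (1 / p) ^ card T * real (copies_above n (cycle_edges r n) T))
           \<le> ((4 / p) ^ (r * r) * 2 powr (- t) * exp (t / 2)) * fact n"
proof -
  let ?G = "cycle_edges r n" and ?L = "clique_chain r (m - 2)"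
  define R where "R = ?G - ?L"
  define y where "y = real n powr (- (real r - 1) / (real r + 1))"
  \<comment> \<open>\<open>(1 / p) ^ (r * r)\<close> bounds the weights of the discarded edges, and
    \<open>2 ^ (r * r)\<close> their share in \<open>2 ^ card T\<close>, which is compared with
    \<open>2 powr t\<close>.\<close>
  define c0 where "c0 = (2 / p) ^ (r * r) * 2 powr (- t) * fact n"
  define g where "g A = c0 * ((s\<^sup>2) ^ card A * y ^ runs (blocks r A))" for A
  have finG: "finite ?G" by (rule finite_cycle_edges)
  have LG: "?L \<subseteq> ?G" by (rule clique_chain_subset_cycle[OF r n(1)])
  have finR: "finite R" unfolding R_def using finG by auto
  have cR: "card R \<le> r * r" unfolding R_def by (rule card_cycle_minus_chain_le[OF r n(1)])
  have y0: "0 \<le> y" unfolding y_def by simp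
  have c0: "0 \<le> c0" unfolding c0_def using p by simp
  have g0: "0 \<le> g A" for A unfolding g_def using c0 y0 by simp
  have inj: "inj (\<lambda>T. copy_of T \<pi>)"
    unfolding copy_of_def using inj_image_permutes[OF \<pi>] by (meson inj_def inj_image_eq_iff)
  have img: "{T. T \<subseteq> copy_of ?G \<pi> \<and> t \<le> real (card T)} = (\<lambda>T. copy_of T \<pi>) ` {T\<in>Pow ?G. t \<le> real (card T)}"
  proof -
    have "Pow (copy_of ?G \<pi>) = (\<lambda>T. copy_of T \<pi>) ` Pow ?G"
      unfolding copy_of_def by (rule image_Pow_surj[symmetric]) simp
    then have "T \<subseteq> copy_of ?G \<pi> \<longleftrightarrow> (\<exists>T'\<subseteq>?G. T = copy_of T' \<pi>)" for T by blast
    then show ?thesis by (auto simp: card_copy_of[OF \<pi>])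
  qed
  have "(\<Sum>T\<in>{T. T \<subseteq> copy_of ?G \<pi> \<and> t \<le> real (card T)}. (1 / p) ^ card T * real (copies_above n ?G T))
      = (\<Sum>T\<in>{T\<in>Pow ?G. t \<le> real (card T)}. (1 / p) ^ card T * real (copies_above n ?G (copy_of T \<pi>)))"
    unfolding img by (subst sum.reindex) (use inj in \<open>auto simp: card_copy_of[OF \<pi>] inj_on_def\<close>)
  also have "\<dots> \<le> (\<Sum>T\<in>{T\<in>Pow ?G. t \<le> real (card T)}. g (T \<inter> ?L))"
  proof (rule sum_mono)
    fix T assume T: "T \<in> {T\<in>Pow ?G. t \<le> real (card T)}"
    define A where "A = T \<inter> ?L"
    define D where "D = T - ?L"
    have finT: "finite T" using T finG finite_subset by auto
    have cT: "card T = card A + card D"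
      unfolding A_def D_def using finT by (metis card_Int_Diff)
    have "card D \<le> card R" unfolding D_def R_def using T finG by (intro card_mono) auto
    then have cD: "card D \<le> r * r" using cR by simp
    have "2 powr t \<le> 2 powr (real (card A) + real (card D))"
      using T cT by (intro powr_mono) auto
    also have "\<dots> = 2 ^ card A * 2 ^ card D" by (simp add: powr_add powr_realpow)
    also have "\<dots> \<le> 2 ^ card A * 2 ^ (r * r)" using cD by (intro mult_left_mono power_increasing) auto
    finally have two: "1 \<le> 2 ^ card A * 2 ^ (r * r) * 2 powr (- t)"
      by (simp add: powr_minus field_simps)
    have "real (copies_above n ?G (copy_of T \<pi>)) \<le> real (copies_above n ?G A)"
      using copies_above_image_le[OF \<pi>, of ?G T] copies_above_antimono[of A T n ?G] unfolding A_def by simp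
    then have "(1 / p) ^ card T * real (copies_above n ?G (copy_of T \<pi>)) \<le> (1 / p) ^ card T * real (copies_above n ?G A)"
      using p by (intro mult_left_mono) auto
    also have "\<dots> = (1 / p) ^ card D * ((1 / p) ^ card A * real (copies_above n ?G A))"
      unfolding cT power_add by simp
    \<comment> \<open>The factor 2 in the hypothesis on \<open>p\<close> permits
      \<open>s / sqrt 2\<close> in place of \<open>s\<close>; multiplying by
      \<open>2 ^ card A\<close> afterwards restores \<open>s^2\<close> per edge.\<close>
    also have "\<dots> \<le> (1 / p) ^ (r * r) * (fact n * (((s / sqrt 2)\<^sup>2) ^ card A * y ^ runs (blocks r A)))"
    proof (rule mult_mono)
      show "(1 / p) ^ card A * real (copies_above n ?G A)
          \<le> fact n * (((s / sqrt 2)\<^sup>2) ^ card A * y ^ runs (blocks r A))"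
        unfolding y_def
        by (rule weighted_copies_above_chain_le[OF r n])
           (use p in \<open>auto simp: A_def power_divide\<close>)
      show "(1 / p) ^ card D \<le> (1 / p) ^ (r * r)" using cD p by (intro power_increasing) auto
    qed (use p in auto)
    also have "\<dots> \<le> (1 / p) ^ (r * r) * (fact n * (((s / sqrt 2)\<^sup>2) ^ card A * y ^ runs (blocks r A)))
        * (2 ^ card A * 2 ^ (r * r) * 2 powr (- t))"
      using mult_left_mono[OF two, of "(1 / p) ^ (r * r) * (fact n * (((s / sqrt 2)\<^sup>2) ^ card A * y ^ runs (blocks r A)))"]
        p y0 by simp
    also have "\<dots> = g A"
      unfolding g_def c0_def by (simp add: power_divide field_simps)
    finally show "(1 / p) ^ card T * real (copies_above n ?G (copy_of T \<pi>)) \<le> g (T \<inter> ?L)" unfolding A_def .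
  qed
  also have "\<dots> \<le> (\<Sum>T\<in>Pow ?G. g (T \<inter> ?L))"
    by (rule sum_mono2) (use finG g0 in auto)
  also have "\<dots> \<le> (\<Sum>(A, D)\<in>Pow ?L \<times> Pow R. g A)"
  proof -
    \<comment> \<open>\<open>T\<close> is determined by its parts inside and outside the chain. The
      summand ignores the outer part, which thus contributes only the number of subsets of
      \<open>R\<close>.\<close>
    have injh: "inj_on (\<lambda>T. (T \<inter> ?L, T - ?L)) (Pow ?G)" by (rule inj_onI) blast
    have "(\<Sum>T\<in>Pow ?G. g (T \<inter> ?L)) = (\<Sum>(A, D)\<in>(\<lambda>T. (T \<inter> ?L, T - ?L)) ` Pow ?G. g A)"
      by (subst sum.reindex[OF injh]) simp
    also have "\<dots> \<le> (\<Sum>(A, D)\<in>Pow ?L \<times> Pow R. g A)"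
      by (rule sum_mono2) (use finR finite_clique_chain g0 in \<open>auto simp: R_def\<close>)
    finally show ?thesis .
  qed
  also have "\<dots> = 2 ^ card R * (\<Sum>A\<in>Pow ?L. g A)"
    using finR by (simp add: sum.cartesian_product[symmetric] card_Pow sum_distrib_left)
  also have "\<dots> \<le> 2 ^ (r * r) * (\<Sum>A\<in>Pow ?L. g A)"
    using cR g0 by (intro mult_right_mono power_increasing sum_nonneg) auto
  also have "(\<Sum>A\<in>Pow ?L. g A) = c0 * (\<Sum>A\<in>Pow ?L. (s\<^sup>2) ^ card A * y ^ runs (blocks r A))"
    unfolding g_def by (simp add: sum_distrib_left)
  also have "2 ^ (r * r) * \<dots> \<le> 2 ^ (r * r) * (c0 * exp (t / 2))"
  proof (intro mult_left_mono c0)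
    have "(\<Sum>A\<in>Pow ?L. (s\<^sup>2) ^ card A * y ^ runs (blocks r A))
        \<le> exp (2 * (2 ^ (r * r) * s) * (y * real (card (blocks r ?L))))"
      by (rule sum_chain_subsets_le[OF r order_refl s(1) _ y0]) (use s in simp)
    also have "\<dots> \<le> exp (t / 2)"
    proof -
      have "blocks r ?L \<subseteq> (\<lambda>u. u div r) ` {..<n}"
        using LG cycle_edges_subset[OF n(2), of r] unfolding blocks_def by (auto simp: nsets_def)
      then have "card (blocks r ?L) \<le> card ((\<lambda>u. u div r) ` {..<n})" by (intro card_mono) auto
      also have "\<dots> \<le> n" using card_image_le[of "{..<n}"] by simp
      finally have "y * real (card (blocks r ?L)) \<le> y * real n" using y0 by (intro mult_left_mono) auto
      \<comment> \<open>The identity \<open>y * n = t\<close> that dictates the choice of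
        \<open>t\<close>.\<close>
      also have "\<dots> = real n powr (- (real r - 1) / (real r + 1) + 1)"
        unfolding y_def powr_add using n(2) by simp
      also have "- (real r - 1) / (real r + 1) + 1 = 2 / (real r + 1)" by (simp add: field_simps)
      finally have "y * real (card (blocks r ?L)) \<le> t" unfolding t .
      then have "2 * (2 ^ (r * r) * s) * (y * real (card (blocks r ?L))) \<le> 2 * (1 / 4) * t"
        using s y0 by (intro mult_mono) auto
      then show ?thesis by simp
    qed
    finally show "(\<Sum>A\<in>Pow ?L. (s\<^sup>2) ^ card A * y ^ runs (blocks r A)) \<le> exp (t / 2)" .
  qed auto
  also have "\<dots> = ((4 / p) ^ (r * r) * 2 powr (- t) * exp (t / 2)) * fact n"
  proof -
    have "(4 / p) ^ (r * r) = 2 ^ (r * r) * (2 / p) ^ (r * r)"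
      by (simp add: power_mult_distrib[symmetric])
    then show ?thesis unfolding c0_def by simp
  qed
  finally show ?thesis .
qed

lemma subset_exp_cycle_ge:
  fixes s p :: real
  assumes r: "3 \<le> r" and n: "n = m * (r - 2)" "0 < n"
    and p: "0 < p" "2 * p \<le> 1" "2 * (exp 1 * (2 * real r))\<^sup>2 * real n powr (- 2 / (real r + 1)) \<le> s\<^sup>2 * p"
    and s: "0 \<le> s" "2 ^ (r * r) * s \<le> 1 / 4" and t: "t = real n powr (2 / (real r + 1))"
    and m: "2 * real r * t < real m"
  shows "(1 - 2 * ((4 / p) ^ (r * r) * 2 powr (- t) * exp (t / 2)))
            / (1 + 2 * (exp (4 * (2 ^ (r * r) * s)) - 1))
         \<le> subset_exp (nsets {..<n} 2) (2 * p)
              (\<lambda>W. of_bool (contains_copy (clique_cycle r 2 n) ({..<n}, W)))"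
proof -
  let ?G = "cycle_edges r n" and ?I = "{\<pi>. \<pi> permutes {..<n}}"
  have GE: "?G \<subseteq> nsets {..<n} 2" by (rule cycle_edges_subset[OF n(2)])
  have cI: "real (card ?I) = fact n" using card_permutations[of "{..<n}" n] by simp
  have p': "(exp 1 * (2 * real r))\<^sup>2 * real n powr (- 2 / (real r + 1)) \<le> s\<^sup>2 * p"
  proof -
    have "0 \<le> (exp 1 * (2 * real r))\<^sup>2 * real n powr (- 2 / (real r + 1))" by simp
    then show ?thesis using p(3) by linarith
  qed
  have "(\<lambda>W. of_bool (contains_copy (clique_cycle r 2 n) ({..<n}, W)) :: real)
      = (\<lambda>W. of_bool (\<exists>\<pi>\<in>?I. copy_of ?G \<pi> \<subseteq> W))"
  proof
    fix W
    have cc: "clique_cycle r 2 n = ({..<n}, ?G)" by (simp add: clique_cycle_def)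
    have "e \<subseteq> {..<n}" if "e \<in> ?G" for e using that GE by (auto simp: nsets_def)
    from contains_copy_iff_permutation[of ?G n W, OF this, folded cc]
    show "of_bool (contains_copy (clique_cycle r 2 n) ({..<n}, W))
        = (of_bool (\<exists>\<pi>\<in>?I. copy_of ?G \<pi> \<subseteq> W) :: real)"
      by (simp only:)
  qed
  moreover have "(1 - 2 * ((4 / p) ^ (r * r) * 2 powr (- t) * exp (t / 2)))
            / (1 + 2 * (exp (4 * (2 ^ (r * r) * s)) - 1))
      \<le> subset_exp (nsets {..<n} 2) (2 * p) (\<lambda>W. of_bool (\<exists>\<pi>\<in>?I. copy_of ?G \<pi> \<subseteq> W))"
  proof (rule two_round_lower_bound[where t = t])
    show "finite (nsets {..<n} 2)" by (simp add: finite_imp_finite_nsets)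
    show "finite ?I" by (rule finite_permutations_lessThan)
    show "?I \<noteq> {}" using permutes_id by blast
    show "copy_of ?G \<pi> \<subseteq> nsets {..<n} 2" if "\<pi> \<in> ?I" for \<pi>
    proof -
      have per: "\<pi> permutes {..<n}" using that by simp
      have "\<pi> ` e \<in> nsets {..<n} 2" if "e \<in> ?G" for e
      proof -
        have e: "e \<subseteq> {..<n}" "finite e" "card e = 2" using that GE by (auto simp: nsets_def)
        have "\<pi> ` e \<subseteq> {..<n}" using e permutes_image[OF per] by blast
        moreover have "card (\<pi> ` e) = 2" using e permutes_inj_on[OF per] by (simp add: card_image)
        ultimately show ?thesis using e by (auto simp: nsets_def)
      qed
      then show ?thesis unfolding copy_of_def by auto
    qed
    show "(\<Sum>T\<in>{T. T \<subseteq> copy_of ?G \<pi> \<and> t \<le> real (card T)}. (1 / p) ^ card T * real (card {j\<in>?I. T \<subseteq> copy_of ?G j}))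
        \<le> (4 / p) ^ (r * r) * 2 powr (- t) * exp (t / 2) * real (card ?I)" if "\<pi> \<in> ?I" for \<pi>
      using large_fragment_sum_le[OF r n p(1) _ p(3) s t, of \<pi>] p that unfolding cI copies_above_def by simp
    show "(\<Sum>T\<in>Pow F - {{}}. (1 / p) ^ card T * real (card {j\<in>?I. T \<subseteq> copy_of ?G j}))
        \<le> (exp (4 * (2 ^ (r * r) * s)) - 1) * real (card ?I)"
      if "\<pi> \<in> ?I" "F \<subseteq> copy_of ?G \<pi>" "real (card F) < t" for \<pi> F
      using small_fragment_sum_le[OF r n p(1) p' s(1), of \<pi> F] s m that unfolding cI copies_above_def t by simp
  qed (use p s in auto)
  ultimately show ?thesis by simp
qed

subsection \<open>The threshold\<close>

text \<open>First moment over permutations, using the edges of the chain only. Their number misses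
  \<open>(r + 1) / 2\<close> per vertex by a bounded amount, so the powers of \<open>n\<close>
  cancel up to \<open>n ^ (2 * r)\<close>. The factor \<open>1 / 2\<close> per edge is exponentially
  small and beats this.\<close>

lemma subset_exp_cycle_le:
  fixes p :: real
  assumes r: "3 \<le> r" and n: "n = m * (r - 2)" "2 * r \<le> n"
    and p: "0 \<le> p" "p \<le> 1" "p \<le> 1 / 2 * real n powr (- 2 / (real r + 1))"
  shows "subset_exp (nsets {..<n} 2) p (\<lambda>W. of_bool (contains_copy (clique_cycle r 2 n) ({..<n}, W)))
           \<le> (1 / 2) ^ (n - 2 * r) * real n ^ (2 * r)"
proof -
  let ?G = "cycle_edges r n" and ?I = "{\<pi>. \<pi> permutes {..<n}}" and ?E = "nsets {..<n} 2 :: nat set set"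
  let ?L = "clique_chain r (m - 2)"
  have n0: "0 < n" using n r by linarith
  have GE: "?G \<subseteq> ?E" by (rule cycle_edges_subset[OF n0])
  have finE: "finite ?E" by (simp add: finite_imp_finite_nsets)
  have cc: "clique_cycle r 2 n = ({..<n}, ?G)" by (simp add: clique_cycle_def)
  have sub: "e \<subseteq> {..<n}" if "e \<in> ?G" for e using that GE by (auto simp: nsets_def)
  have iff: "contains_copy (clique_cycle r 2 n) ({..<n}, W) \<longleftrightarrow> (\<exists>\<pi>\<in>?I. copy_of ?G \<pi> \<subseteq> W)" for W
    by (rule contains_copy_iff_permutation[of ?G n W, folded cc]) (rule sub)
  define \<mu> where "\<mu> \<pi> = subset_exp ?E p (\<lambda>W. of_bool (copy_of ?G \<pi> \<subseteq> W))" for \<pi>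
  have mu: "\<mu> \<pi> \<le> p ^ card ?G" if \<pi>: "\<pi> \<in> ?I" for \<pi>
  proof (cases "copy_of ?G \<pi> \<subseteq> ?E")
    case True
    then have "\<mu> \<pi> = p ^ card (copy_of ?G \<pi>)" unfolding \<mu>_def by (rule subset_exp_superset[OF finE])
    also have "card (copy_of ?G \<pi>) = card ?G" using \<pi> by (intro card_copy_of) auto
    finally show ?thesis by simp
  next
    case False
    then have "\<mu> \<pi> = 0" unfolding \<mu>_def subset_exp_def by (intro sum.neutral) auto
    then show ?thesis using p by simp
  qed
  have "subset_exp ?E p (\<lambda>W. of_bool (contains_copy (clique_cycle r 2 n) ({..<n}, W)))
      \<le> subset_exp ?E p (\<lambda>W. \<Sum>\<pi>\<in>?I. of_bool (copy_of ?G \<pi> \<subseteq> W))"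
  proof (rule subset_exp_mono[OF p(1,2)])
    fix W
    show "of_bool (contains_copy (clique_cycle r 2 n) ({..<n}, W))
        \<le> (\<Sum>\<pi>\<in>?I. of_bool (copy_of ?G \<pi> \<subseteq> W) :: real)"
    proof (cases "contains_copy (clique_cycle r 2 n) ({..<n}, W)")
      case True
      then obtain \<pi> where \<pi>: "\<pi> \<in> ?I" "copy_of ?G \<pi> \<subseteq> W" using iff by blast
      have "of_bool (copy_of ?G \<pi> \<subseteq> W) \<le> (\<Sum>\<pi>\<in>?I. of_bool (copy_of ?G \<pi> \<subseteq> W) :: real)"
        by (rule member_le_sum) (use \<pi> finite_permutations_lessThan in auto)
      then show ?thesis using \<pi> True by simp
    qed (simp add: sum_nonneg)
  qed
  also have "\<dots> = (\<Sum>\<pi>\<in>?I. \<mu> \<pi>)" unfolding \<mu>_def by (rule subset_exp_sum)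
  also have "\<dots> \<le> (\<Sum>\<pi>\<in>?I. p ^ card ?G)" by (intro sum_mono mu)
  also have "\<dots> = fact n * p ^ card ?G" using card_permutations[of "{..<n}" n] by simp
  also have "\<dots> \<le> real n ^ n * p ^ card ?L"
  proof (rule mult_mono)
    show "fact n \<le> real n ^ n" using fact_le_power[of n, where ?'a = real] by simp
    show "p ^ card ?G \<le> p ^ card ?L"
      using p clique_chain_subset_cycle[OF r n(1)] finite_cycle_edges
      by (intro power_decreasing card_mono) auto
  qed (use p in auto)
  also have "\<dots> \<le> real n ^ n * (1 / 2 * real n powr (- 2 / (real r + 1))) ^ card ?L"
    using p by (intro mult_left_mono power_mono) auto
  also have "\<dots> = (1 / 2) ^ card ?L * (real n powr real n * real n powr (real (card ?L) * (- 2 / (real r + 1))))"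
    using n0 by (simp only: power_mult_distrib powr_power powr_realpow of_nat_0_less_iff) (simp add: powr_power)
  also have "\<dots> = (1 / 2) ^ card ?L * real n powr (real n + real (card ?L) * (- 2 / (real r + 1)))"
    by (simp only: powr_add)
  also have "\<dots> \<le> (1 / 2) ^ (n - 2 * r) * real n powr real (2 * r)"
  proof (rule mult_mono)
    have "n - 2 * r \<le> (m - 2) * (r - 2)" unfolding n(1) by (simp add: diff_mult_distrib)
    then have "(n - 2 * r) * (r + 1) \<le> (m - 2) * (r - 2) * (r + 1)" by (rule mult_le_mono1)
    also have "\<dots> \<le> 2 * card ?L" using clique_chain_card_ge[OF r, of "m - 2"] by (simp only: mult.assoc)
    finally have L0: "real ((n - 2 * r) * (r + 1)) \<le> real (2 * card ?L)" by (simp only: of_nat_le_iff)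
    have d: "real (n - 2 * r) = real n - 2 * real r" using n(2) by (simp add: of_nat_diff)
    have "real ((n - 2 * r) * (r + 1)) = (real n - 2 * real r) * (real r + 1)"
      unfolding of_nat_mult d by simp
    then have L: "(real n - 2 * real r) * (real r + 1) \<le> 2 * real (card ?L)"
      using L0 by (simp only: of_nat_mult of_nat_numeral)
    have "(real n - 2 * real r) * 2 \<le> (real n - 2 * real r) * (real r + 1)"
      using n(2) r by (intro mult_left_mono) auto
    then have "real (n - 2 * r) \<le> real (card ?L)" using L n(2) by (simp add: of_nat_diff)
    then show "(1 / 2 :: real) ^ card ?L \<le> (1 / 2) ^ (n - 2 * r)" by (intro power_decreasing) auto
    have "real n - 2 * real r \<le> 2 * real (card ?L) / (real r + 1)"
      using L by (subst pos_le_divide_eq) auto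
    then have "real n + real (card ?L) * (- 2 / (real r + 1)) \<le> real (2 * r)" by (simp add: mult.commute)
    then show "real n powr (real n + real (card ?L) * (- 2 / (real r + 1))) \<le> real n powr real (2 * r)"
      using n0 by (intro powr_mono) auto
  qed auto
  also have "real n powr real (2 * r) = real n ^ (2 * r)" using n0 by (intro powr_realpow) simp
  finally show ?thesis .
qed

section \<open>Limits and choice of constants\<close>

lemma tendsto_half_power_times_poly: "(\<lambda>n. (1 / 2) ^ (n - k) * real n ^ k) \<longlonglongrightarrow> 0"
proof -
  have "((\<lambda>x::real. x ^ k / exp x) \<longlongrightarrow> 0) at_top" by (rule tendsto_power_div_exp_0)
  moreover have "filterlim (\<lambda>n. ln 2 * real n) at_top sequentially"
    by (intro filterlim_tendsto_pos_mult_at_top[OF tendsto_const _ filterlim_real_sequentially]) simp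
  ultimately have "(\<lambda>n. (ln 2 * real n) ^ k / exp (ln 2 * real n)) \<longlonglongrightarrow> 0"
    by (rule filterlim_compose)
  then have "(\<lambda>n. 2 ^ k / (ln 2) ^ k * ((ln 2 * real n) ^ k / exp (ln 2 * real n))) \<longlonglongrightarrow> 2 ^ k / (ln 2) ^ k * 0"
    by (intro tendsto_mult tendsto_const)
  then have "(\<lambda>n. 2 ^ k / (ln 2) ^ k * ((ln 2 * real n) ^ k / exp (ln 2 * real n))) \<longlonglongrightarrow> 0" by simp
  then show ?thesis
  proof (rule Lim_transform_eventually)
    show "\<forall>\<^sub>F n in sequentially. 2 ^ k / (ln 2) ^ k * ((ln 2 * real n) ^ k / exp (ln 2 * real n))
        = (1 / 2) ^ (n - k) * real n ^ k"
      using eventually_ge_at_top[of k]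
    proof eventually_elim
      case (elim n)
      have "exp (ln 2 * real n) = 2 ^ n" by (simp add: exp_of_nat2_mult)
      moreover have "(2::real) ^ n = 2 ^ (n - k) * 2 ^ k" using elim by (simp flip: power_add)
      ultimately show ?case by (simp add: power_mult_distrib power_divide)
    qed
  qed
qed

lemma tendsto_power_exp_decay:
  "((\<lambda>t::real. (4 * t) ^ k * 2 powr (- t) * exp (t / 2)) \<longlongrightarrow> 0) at_top"
proof -
  \<comment> \<open>The rate at which \<open>2 powr (- t)\<close> beats \<open>exp (t / 2)\<close>;
    it is positive because \<open>ln 2 > 1 / 2\<close>.\<close>
  define c where "c = ln 2 - (1 / 2 :: real)"
  have c: "0 < c" unfolding c_def using ln2_ge_two_thirds by simp
  have "((\<lambda>x::real. x ^ k / exp x) \<longlongrightarrow> 0) at_top" by (rule tendsto_power_div_exp_0)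
  moreover have "filterlim (\<lambda>t. c * t) at_top at_top"
    by (intro filterlim_tendsto_pos_mult_at_top[OF tendsto_const c filterlim_ident])
  ultimately have "((\<lambda>t. (c * t) ^ k / exp (c * t)) \<longlongrightarrow> 0) at_top" by (rule filterlim_compose)
  then have "((\<lambda>t. (4 / c) ^ k * ((c * t) ^ k / exp (c * t))) \<longlongrightarrow> (4 / c) ^ k * 0) at_top"
    by (intro tendsto_mult tendsto_const)
  moreover have "(4 / c) ^ k * ((c * t) ^ k / exp (c * t)) = (4 * t) ^ k * 2 powr (- t) * exp (t / 2)" for t
  proof -
    have e: "exp (- (c * t)) = 2 powr (- t) * exp (t / 2)"
      unfolding powr_def c_def by (simp add: algebra_simps flip: exp_add)
    have "(4 / c) ^ k * ((c * t) ^ k / exp (c * t)) = (4 / c * (c * t)) ^ k * exp (- (c * t))"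
      by (simp only: power_mult_distrib exp_minus divide_inverse mult.assoc)
    also have "4 / c * (c * t) = 4 * t" using c by simp
    finally show ?thesis unfolding e by (simp only: mult.assoc)
  qed
  ultimately show ?thesis by simp
qed

lemma filterlim_powr_sequentially:
  assumes "0 < a"
  shows "filterlim (\<lambda>n. real n powr a) at_top sequentially"
proof -
  have "filterlim (\<lambda>n. a * ln (real n)) at_top sequentially"
    by (intro filterlim_tendsto_pos_mult_at_top[OF tendsto_const assms]
        filterlim_compose[OF ln_at_top filterlim_real_sequentially])
  then have "filterlim (\<lambda>n. exp (a * ln (real n))) at_top sequentially"
    by (rule filterlim_compose[OF exp_at_top])
  moreover have "eventually (\<lambda>n. exp (a * ln (real n)) = real n powr a) sequentially"
    using eventually_gt_at_top[of 0] by eventually_elim (simp add: powr_def)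
  ultimately show ?thesis by (rule filterlim_mono_eventually[OF _ order_refl order_refl])
qed

text \<open>Each round has density \<open>p = q / 2\<close>. The hypothesis on \<open>q\<close>
  forces \<open>1 / t <= p\<close>, so \<open>4 / p\<close> is replaced by \<open>4 * t\<close> and
  the error terms no longer depend on \<open>q\<close>.\<close>

lemma subset_exp_cycle_ge_explicit:
  fixes s q :: real
  assumes r: "3 \<le> r" and n: "(r - 2) dvd n" "4 * r ^ 4 < n"
    and q: "q \<le> 1" "4 * (exp 1 * (2 * real r))\<^sup>2 * real n powr (- 2 / (real r + 1)) \<le> s\<^sup>2 * q"
    and s: "0 < s" "2 ^ (r * r) * s \<le> 1 / 4" and t: "t = real n powr (2 / (real r + 1))"
  shows "1 - 2 * ((4 * t) ^ (r * r) * 2 powr (- t) * exp (t / 2)) - 2 * (exp (4 * (2 ^ (r * r) * s)) - 1)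
    \<le> subset_exp (nsets {..<n} 2) q (\<lambda>W. of_bool (contains_copy (clique_cycle r 2 n) ({..<n}, W)))"
proof -
  obtain m where m: "n = m * (r - 2)" using n(1) by (metis dvd_def mult.commute)
  have n0: "0 < n" using n(2) by simp
  define p where "p = q / 2"
  define \<eta> where "\<eta> = (4 / p) ^ (r * r) * 2 powr (- t) * exp (t / 2)"
  define \<eta>' where "\<eta>' = (4 * t) ^ (r * r) * 2 powr (- t) * exp (t / 2)"
  define \<delta> where "\<delta> = exp (4 * (2 ^ (r * r) * s)) - 1"
  have \<delta>: "0 \<le> \<delta>" unfolding \<delta>_def using s by simp
  have t0: "0 < t" unfolding t using n0 by simp
  have ti: "real n powr (- 2 / (real r + 1)) = 1 / t"
    unfolding t using n0 by (simp add: powr_minus_divide)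
  have "(1::real) \<le> 2 ^ (r * r)" by simp
  then have "1 * s \<le> 2 ^ (r * r) * s" using s(1) by (intro mult_right_mono) auto
  then have "s \<le> 1" using s(2) by linarith
  then have s1: "s\<^sup>2 \<le> 1" using s by (simp add: power_le_one)
  have "1 \<le> exp 1 * (2 * real r)" using r mult_mono[of 1 "exp 1 :: real" 1 "2 * real r"] by simp
  then have K: "1 \<le> (exp 1 * (2 * real r))\<^sup>2" by (rule one_le_power)
  have p2: "2 * (exp 1 * (2 * real r))\<^sup>2 * (1 / t) \<le> s\<^sup>2 * p"
    using q(2) unfolding ti p_def by simp
  have "1 / t \<le> 2 * (exp 1 * (2 * real r))\<^sup>2 * (1 / t)"
    using mult_right_mono[of 1 "2 * (exp 1 * (2 * real r))\<^sup>2" "1 / t"] K t0 by simp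
  then have sp: "1 / t \<le> s\<^sup>2 * p" using p2 by linarith
  moreover have "0 < 1 / t" using t0 by simp
  ultimately have "0 < s\<^sup>2 * p" by linarith
  then have p0: "0 < p" using s by (simp add: zero_less_mult_iff)
  have "s\<^sup>2 * p \<le> 1 * p" using s1 p0 by (intro mult_right_mono) auto
  then have "1 / t \<le> p" using sp by linarith
  then have "4 / p \<le> 4 * t" using t0 p0 by (simp add: field_simps)
  then have \<eta>\<eta>': "\<eta> \<le> \<eta>'" unfolding \<eta>_def \<eta>'_def using p0 by (intro mult_right_mono power_mono) auto
  have \<eta>0: "0 \<le> \<eta>" unfolding \<eta>_def using p0 by simp
  have m_large: "2 * real r * t < real m"
  proof -
    \<comment> \<open>\<open>2 / (r + 1) <= 1 / 2\<close> holds because \<open>r >= 3\<close>. The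
      size condition \<open>4 * r ^ 4 < n\<close> then gives \<open>2 * r^2 * sqrt n < n\<close>,
      enough rotations for the small fragments.\<close>
    have "t \<le> real n powr (1 / 2)" unfolding t using n0 r by (intro powr_mono) (auto simp: field_simps)
    then have tn: "t \<le> sqrt (real n)" using n0 by (simp add: powr_half_sqrt)
    have "real (4 * r ^ 4) < real n" using n(2) by (simp only: of_nat_less_iff)
    then have "2 * (real r)\<^sup>2 < sqrt (real n)"
      by (intro real_less_rsqrt) (simp add: power_mult_distrib flip: power_mult)
    then have "2 * (real r)\<^sup>2 * sqrt (real n) < sqrt (real n) * sqrt (real n)"
      using n0 by (intro mult_strict_right_mono) auto
    then have big: "2 * (real r)\<^sup>2 * sqrt (real n) < real n" by simp
    have "2 * real r * t * real (r - 2) \<le> 2 * real r * sqrt (real n) * real r"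
      using tn t0 by (intro mult_mono) auto
    also have "\<dots> = 2 * (real r)\<^sup>2 * sqrt (real n)" by (simp add: power2_eq_square)
    also have "\<dots> < real m * real (r - 2)" using big unfolding m by simp
    finally show ?thesis by (rule mult_right_less_imp_less) simp
  qed
  have "(1 - 2 * \<eta>) / (1 + 2 * \<delta>)
      \<le> subset_exp (nsets {..<n} 2) (2 * p) (\<lambda>W. of_bool (contains_copy (clique_cycle r 2 n) ({..<n}, W)))"
    unfolding \<eta>_def \<delta>_def
    by (rule subset_exp_cycle_ge[OF r m n0 p0 _ _ _ s(2) t m_large]) (use q s p2 ti in \<open>auto simp: p_def\<close>)
  moreover have "1 - 2 * \<eta>' - 2 * \<delta> \<le> (1 - 2 * \<eta>) / (1 + 2 * \<delta>)"
  proof -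
    have "(1 - 2 * \<eta> - 2 * \<delta>) * (1 + 2 * \<delta>) = 1 - 2 * \<eta> - 4 * (\<eta> * \<delta>) - 4 * (\<delta> * \<delta>)"
      by (simp add: algebra_simps)
    also have "\<dots> \<le> 1 - 2 * \<eta>"
      using mult_nonneg_nonneg[OF \<eta>0 \<delta>] mult_nonneg_nonneg[OF \<delta> \<delta>] by linarith
    finally have "1 - 2 * \<eta> - 2 * \<delta> \<le> (1 - 2 * \<eta>) / (1 + 2 * \<delta>)"
      using \<delta> by (subst pos_le_divide_eq) auto
    then show ?thesis using \<eta>\<eta>' by linarith
  qed
  ultimately show ?thesis unfolding \<eta>'_def \<delta>_def p_def by simp
qed

theorem theorem1p2:
  fixes r :: nat
  assumes "r \<ge> 3"
  defines "F \<equiv> inf sequentially (principal {n. (r - 2) dvd n})"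
  shows "\<exists>pstar :: nat \<Rightarrow> real.
           pstar \<in> \<Theta>[F](\<lambda>n. real n powr (- 2 / (real r + 1))) \<and>
           is_threshold F (\<lambda>n G. contains_copy (clique_cycle r 2 n) G) pstar"
proof (intro exI conjI)
  let ?f = "\<lambda>n::nat. real n powr (- 2 / (real r + 1))"
  \<comment> \<open>This instantiates the threshold function by the power of \<open>n\<close>
    itself.\<close>
  show "?f \<in> \<Theta>[F](?f)" by simp
  have seqF: "eventually P F" if "eventually P sequentially" for P
    using that unfolding F_def by (rule filter_leD[OF inf_le1])
  have dvdF: "eventually (\<lambda>n. (r - 2) dvd n) F" unfolding F_def eventually_inf_principal by simp
  have FS: "F \<le> sequentially" unfolding F_def by simp
  show "is_threshold F (\<lambda>n G. contains_copy (clique_cycle r 2 n) G) ?f"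
    unfolding is_threshold_def
  proof (intro allI impI conjI)
    fix p :: "nat \<Rightarrow> real"
    assume p01: "\<forall>n. 0 \<le> p n \<and> p n \<le> 1" and "p \<in> o[F](?f)"
    then have "eventually (\<lambda>n. norm (p n) \<le> 1 / 2 * norm (?f n)) F"
      by (intro landau_o.smallD) auto
    then have "eventually (\<lambda>n. measure_pmf.prob (random_graph n (p n)) {G. contains_copy (clique_cycle r 2 n) G}
        \<le> (1 / 2) ^ (n - 2 * r) * real n ^ (2 * r)) F"
      using dvdF seqF[OF eventually_ge_at_top[of "2 * r"]]
    proof eventually_elim
      case (elim n)
      obtain m where m: "n = m * (r - 2)" using elim(2) by (metis dvd_def mult.commute)
      show ?case
        unfolding prob_random_graph[OF p01[rule_format, THEN conjunct1] p01[rule_format, THEN conjunct2]]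
        by (rule subset_exp_cycle_le[OF assms(1) m elim(3)]) (use p01 elim(1) in auto)
    qed
    moreover have "((\<lambda>n. (1 / 2) ^ (n - 2 * r) * real n ^ (2 * r)) \<longlongrightarrow> 0) F"
      by (rule tendsto_mono[OF FS tendsto_half_power_times_poly])
    ultimately show "((\<lambda>n. measure_pmf.prob (random_graph n (p n)) {G. contains_copy (clique_cycle r 2 n) G}) \<longlongrightarrow> 0) F"
      by (rule tendsto_sandwich[OF _ _ tendsto_const, rotated]) simp
  next
    fix p :: "nat \<Rightarrow> real"
    assume p01: "\<forall>n. 0 \<le> p n \<and> p n \<le> 1" and om: "p \<in> \<omega>[F](?f)"
    show "((\<lambda>n. measure_pmf.prob (random_graph n (p n)) {G. contains_copy (clique_cycle r 2 n) G}) \<longlongrightarrow> 1) F"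
    proof (rule tendstoI)
      fix \<epsilon> :: real assume \<epsilon>: "0 < \<epsilon>"
      \<comment> \<open>\<open>x = 2 ^ (r * r) * s\<close> is the weight per block. The bound
        \<open>1 / 4\<close> is required by the fragment sums, and the logarithm makes
        \<open>exp (4 * x) - 1\<close> at most \<open>\<epsilon> / 8\<close>; both errors enter
        doubled, so their total is below \<open>\<epsilon>\<close>.\<close>
      define x where "x = min (1 / 4) (ln (1 + \<epsilon> / 8) / 4)"
      define s where "s = x / 2 ^ (r * r)"
      have x: "0 < x" "x \<le> 1 / 4" unfolding x_def using \<epsilon> by auto
      have s: "0 < s" "2 ^ (r * r) * s = x" unfolding s_def using x by auto
      have "exp (4 * x) \<le> exp (ln (1 + \<epsilon> / 8))" unfolding x_def exp_le_cancel_iff by linarith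
      then have ex: "exp (4 * x) - 1 \<le> \<epsilon> / 8" using \<epsilon> by simp
      \<comment> \<open>The constant that turns \<open>p >= C * n powr (- 2 / (r + 1))\<close> into
        the density condition for this \<open>s\<close>; it depends on \<open>r\<close> and
        \<open>\<epsilon>\<close> but not on \<open>n\<close>.\<close>
      define C where "C = 4 * (exp 1 * (2 * real r))\<^sup>2 / s\<^sup>2"
      have "0 < C" unfolding C_def using s assms(1) by simp
      from landau_omega.smallD[OF om this]
      have ev1: "eventually (\<lambda>n. norm (p n) \<ge> C * norm (?f n)) F" .
      define h where "h t = (4 * t) ^ (r * r) * 2 powr (- t) * exp (t / 2)" for t :: real
      have "filterlim (\<lambda>n. real n powr (2 / (real r + 1))) at_top sequentially"
        by (rule filterlim_powr_sequentially) simp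
      then have "((\<lambda>n. h (real n powr (2 / (real r + 1)))) \<longlonglongrightarrow> 0)"
        unfolding h_def by (rule filterlim_compose[OF tendsto_power_exp_decay])
      then have "eventually (\<lambda>n. h (real n powr (2 / (real r + 1))) < \<epsilon> / 8) sequentially"
        by (rule order_tendstoD) (use \<epsilon> in simp)
      from ev1 seqF[OF this] dvdF seqF[OF eventually_gt_at_top[of "4 * r ^ 4"]]
      show "eventually (\<lambda>n. dist (measure_pmf.prob (random_graph n (p n)) {G. contains_copy (clique_cycle r 2 n) G}) 1 < \<epsilon>) F"
      proof eventually_elim
        case (elim n)
        have "C * ?f n \<le> p n" using elim(1) p01 by simp
        then have "s\<^sup>2 * (C * ?f n) \<le> s\<^sup>2 * p n" by (intro mult_left_mono) auto
        then have q: "4 * (exp 1 * (2 * real r))\<^sup>2 * ?f n \<le> s\<^sup>2 * p n" unfolding C_def using s by simp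
        have "1 - 2 * h (real n powr (2 / (real r + 1))) - 2 * (exp (4 * (2 ^ (r * r) * s)) - 1)
          \<le> measure_pmf.prob (random_graph n (p n)) {G. contains_copy (clique_cycle r 2 n) G}"
          unfolding h_def prob_random_graph[OF p01[rule_format, THEN conjunct1] p01[rule_format, THEN conjunct2]]
          by (rule subset_exp_cycle_ge_explicit[OF assms(1) elim(3,4) _ q s(1) _ refl]) (use p01 s x in auto)
        moreover have "1 - \<epsilon> < P" if "1 - 2 * a - 2 * b \<le> P" "a < \<epsilon> / 8" "b \<le> \<epsilon> / 8" for a b P
          using that \<epsilon> by linarith
        ultimately have "1 - \<epsilon> < measure_pmf.prob (random_graph n (p n)) {G. contains_copy (clique_cycle r 2 n) G}"
          using elim(2) ex unfolding s(2) by blast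
        moreover have "measure_pmf.prob (random_graph n (p n)) {G. contains_copy (clique_cycle r 2 n) G} \<le> 1"
          by (rule measure_pmf.prob_le_1)
        ultimately show ?case unfolding dist_real_def by linarith
      qed
    qed
  qed
qed

end
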